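(* Let $\mathcal A$ be a real symmetric tensor of order $m$ and dimension $n$, let $\phi(x)=\frac1m\mathcal A x^m$, and let $\{x_k\}$ be the sequence of iterates generated by the Global Newton Algorithm (described in the context) applied to the problem $\min_{x\in\mathbb B}\phi(x)$. Then $\{x_k\}$ is bounded and the sequence $\{\phi(x_k)\}$ is decreasing. Suppose moreover that there is an accumulation point $\bar x$ of $\{x_k\}$ at which the second order sufficient condition holds, i.e. $U_{\bar x}^TF'(\bar x)U_{\bar x}$ is positive definite. Then $\bar x$ is a $Z$-eigenvector of $\mathcal A$ corresponding to the $Z$-eigenvalue $\bar\lambda=\mathcal A\bar x^m$. Moreover, every accumulation point $\tilde x$ of $\{x_k\}$ is a $Z$-eigenvector of $\mathcal A$ corresponding to the $Z$-eigenvalue $\tilde\lambda=\mathcal A\tilde x^m$.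
   Context: Let $m\ge 2$ and $n$ be positive integers, and let $\mathcal A=(a_{i_1\ldots i_m})$, $1\le i_1,\ldots,i_m\le n$, be a real symmetric tensor (entries invariant under permutation of indices). For $x\in\mathbb R^n$, $\mathcal A x^{m-1}\in\mathbb R^n$ has $i$-th entry $\sum_{i_2,\ldots,i_m}a_{ii_2\ldots i_m}x_{i_2}\cdots x_{i_m}$; $\mathcal A x^m=x^T(\mathcal A x^{m-1})\in\mathbb R$; and $\mathcal A x^{m-2}\in\mathbb R^{n\times n}$ has $(i,j)$ entry $\sum_{i_3,\ldots,i_m}a_{iji_3\ldots i_m}x_{i_3}\cdots x_{i_m}$. $\|\cdot\|$ is the Euclidean norm and $\mathbb B=\{x\in\mathbb R^n: x^Tx=1\}$. A vector $x$ is a $Z$-eigenvector of $\mathcal A$ with $Z$-eigenvalue $\lambda\in\mathbb R$ if $\mathcal A x^{m-1}=\lambda x$ and $x^Tx=1$. Let $\phi(x)=\frac1m\mathcal A x^m$, so $\nabla\phi(x)=\mathcal A x^{m-1}$. Let $F(x)=\mathcal A x^{m-1}-(\mathcal A x^m)\,x$, whose Jacobian is $F'(x)=(m-1)\mathcal A x^{m-2}-(\mathcal A x^m) I-m\,x(\mathcal A x^{m-1})^T$; for $x\in\mathbb B$, $F(x)=(I-xx^T)\nabla\phi(x)$. For $x\in\mathbb B$, $U_x\in\mathbb R^{n\times(n-1)}$ is a matrix whose columns form an orthogonal basis of $x^\perp=\{d\in\mathbb R^n: x^Td=0\}$. The second order sufficient condition is said to hold at $x\in\mathbb B$ if $U_x^TF'(x)U_x$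 is positive definite. Curve descent direction: $d\in\mathbb R^n$ is a curve descent direction of a function $g$ at $x\in\mathbb B$ if $g\big(\frac{x+\alpha d}{\|x+\alpha d\|}\big)<g(x)$ for all sufficiently small $\alpha>0$. Newton direction at $x_k\in\mathbb B$: a vector $d_k$ solving $U_{x_k}^TF'(x_k)d_k+U_{x_k}^TF(x_k)=0$ and $x_k^Td_k=0$. Global Newton Algorithm. Fix constants $\sigma\in(0,\frac12)$, $\mu>0$, $\rho\in(0,1)$ and $x_0\in\mathbb B$. For $k=0,1,\ldots$, while $F(x_k)\ne0$: (1) let $d_k$ be the Newton direction at $x_k$; (2) if it does not exist or is not a curve descent direction of $\phi$ at $x_k$, let instead $d_k=-(I-x_kx_k^T)\nabla\phi(x_k)$, or let $d_k$ be the solution of $\big([F'(x_k)]^2+\mu\|F(x_k)\|I\big)d_k+F'(x_k)F(x_k)=0$; (3) with $x_k(\alpha)=\frac{x_k+\alpha d_k}{\|x_k+\alpha d_k\|}$, find by backtracking the largest $\alpha_k\in\{1,\rho,\rho^2,\ldots\}$ satisfying $\phi(x_k(\alpha_k))\le\phi(x_k)+\sigma\alpha_k F(x_k)^Td_k$; (4) let $x_{k+1}=x_k(\alpha_k)$. Statements about accumulation points concern the case in which the algorithm generates an infinite sequence.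
   Formalization: In step (2) the regularized direction is allowed only when it is a curve descent direction of φ at x_k, since otherwise φ can increase; "decreasing" means nonincreasing, with strict decrease whenever F(x_k)^T d_k ≠ 0, since unconditional strict decrease can fail. *)

theory Defs
  imports "HOL-Analysis.Analysis" "HOL-Library.Multiset" "HOL-Library.Extended_Nat"
begin

text \<open>
  A tensor of order \<open>m\<close> and dimension \<open>n = CARD('n)\<close> is a function \<open>A\<close> on index lists;
  only its values on lists of length \<open>m\<close> are ever used.
\<close>

type_synonym 'n tensor = "'n list \<Rightarrow> real"

definition symmetric_tensor :: "nat \<Rightarrow> 'n tensor \<Rightarrow> bool" where
  "symmetric_tensor m A \<longleftrightarrow>
     (\<forall>is js. length is = m \<and> mset is = mset js \<longrightarrow> A is = A js)"

definition tensor_pow1 :: "nat \<Rightarrow> 'n::finite tensor \<Rightarrow> real^'n \<Rightarrow> real^'n" where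
  \<comment> \<open>\<open>A x\<^sup>m\<^sup>-\<^sup>1\<close>\<close>
  "tensor_pow1 m A x =
     (\<chi> i. \<Sum>is\<in>{is. length is = m - 1}. A (i # is) * (\<Prod>k\<leftarrow>is. x $ k))"

definition tensor_pow :: "nat \<Rightarrow> 'n::finite tensor \<Rightarrow> real^'n \<Rightarrow> real" where
  \<comment> \<open>\<open>A x\<^sup>m\<close>\<close>
  "tensor_pow m A x = x \<bullet> tensor_pow1 m A x"

definition tensor_pow2 :: "nat \<Rightarrow> 'n::finite tensor \<Rightarrow> real^'n \<Rightarrow> real^'n^'n" where
  \<comment> \<open>\<open>A x\<^sup>m\<^sup>-\<^sup>2\<close>, used for \<open>m \<ge> 2\<close> only\<close>
  "tensor_pow2 m A x =
     (\<chi> i j. \<Sum>is\<in>{is. length is = m - 2}. A (i # j # is) * (\<Prod>k\<leftarrow>is. x $ k))"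

definition unit_vectors :: "(real^'n) set" where
  "unit_vectors = {x. x \<bullet> x = 1}"

definition Z_eigenpair :: "nat \<Rightarrow> 'n::finite tensor \<Rightarrow> real^'n \<Rightarrow> real \<Rightarrow> bool" where
  "Z_eigenpair m A x l \<longleftrightarrow> tensor_pow1 m A x = l *\<^sub>R x \<and> x \<bullet> x = 1"

definition phi :: "nat \<Rightarrow> 'n::finite tensor \<Rightarrow> real^'n \<Rightarrow> real" where
  "phi m A x = tensor_pow m A x / real m"

definition outer :: "real^'n \<Rightarrow> real^'n \<Rightarrow> real^'n^'n" where
  \<comment> \<open>\<open>x y\<^sup>T\<close>\<close>
  "outer x y = (\<chi> i j. x $ i * y $ j)"

definition F :: "nat \<Rightarrow> 'n::finite tensor \<Rightarrow> real^'n \<Rightarrow> real^'n" where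
  "F m A x = tensor_pow1 m A x - tensor_pow m A x *\<^sub>R x"

definition F' :: "nat \<Rightarrow> 'n::finite tensor \<Rightarrow> real^'n \<Rightarrow> real^'n^'n" where
  \<comment> \<open>the Jacobian of \<open>F\<close> for symmetric \<open>A\<close>\<close>
  "F' m A x = (real m - 1) *\<^sub>R tensor_pow2 m A x - tensor_pow m A x *\<^sub>R mat 1
                - real m *\<^sub>R outer x (tensor_pow1 m A x)"

text \<open>
  The \<open>n \<times> (n - 1)\<close> matrix \<open>U\<^sub>x\<close> is given by its columns \<open>U 0, \<dots>, U (n - 2)\<close>,
  because no type has cardinality \<open>n - 1\<close> when \<open>n = 1\<close>.
  Thus \<open>U\<^sup>T v\<close> has the entries \<open>U i \<bullet> v\<close> and \<open>U\<^sup>T M U\<close> the entries \<open>U i \<bullet> (M *v U j)\<close>.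
\<close>

definition perp_basis :: "real^'n \<Rightarrow> (nat \<Rightarrow> real^'n) \<Rightarrow> bool" where
  "perp_basis x U \<longleftrightarrow>
     (let J = {..<CARD('n) - 1} in
        pairwise (\<lambda>i j. orthogonal (U i) (U j)) J \<and>
        inj_on U J \<and> independent (U ` J) \<and> span (U ` J) = {d. x \<bullet> d = 0})"

definition positive_definite :: "nat \<Rightarrow> (nat \<Rightarrow> nat \<Rightarrow> real) \<Rightarrow> bool" where
  \<comment> \<open>the \<open>k \<times> k\<close> matrix \<open>M\<close>; \<open>U\<^sub>x\<^sup>T F'(x) U\<^sub>x\<close> is symmetric although \<open>F'(x)\<close> need not be\<close>
  "positive_definite k M \<longleftrightarrow>
     (\<forall>z. (\<exists>i<k. z i \<noteq> 0) \<longrightarrow> 0 < (\<Sum>i<k. \<Sum>j<k. z i * M i j * z j))"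

definition second_order_sufficient ::
    "nat \<Rightarrow> 'n::finite tensor \<Rightarrow> (real^'n \<Rightarrow> nat \<Rightarrow> real^'n) \<Rightarrow> real^'n \<Rightarrow> bool" where
  "second_order_sufficient m A U x \<longleftrightarrow>
     positive_definite (CARD('n) - 1) (\<lambda>i j. U x i \<bullet> (F' m A x *v U x j))"

definition curve :: "real^'n \<Rightarrow> real^'n \<Rightarrow> real \<Rightarrow> real^'n" where
  "curve x d \<alpha> = (x + \<alpha> *\<^sub>R d) /\<^sub>R norm (x + \<alpha> *\<^sub>R d)"

definition curve_descent :: "(real^'n \<Rightarrow> real) \<Rightarrow> real^'n \<Rightarrow> real^'n \<Rightarrow> bool" where
  "curve_descent g x d \<longleftrightarrow> (\<forall>\<^sub>F \<alpha> in at_right 0. g (curve x d \<alpha>) < g x)"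

definition newton_direction ::
    "nat \<Rightarrow> 'n::finite tensor \<Rightarrow> (real^'n \<Rightarrow> nat \<Rightarrow> real^'n) \<Rightarrow> real^'n \<Rightarrow> real^'n \<Rightarrow> bool" where
  "newton_direction m A U x d \<longleftrightarrow>
     (\<forall>i < CARD('n) - 1. U x i \<bullet> (F' m A x *v d) + U x i \<bullet> F m A x = 0) \<and> x \<bullet> d = 0"

definition projected_gradient_direction ::
    "nat \<Rightarrow> 'n::finite tensor \<Rightarrow> real^'n \<Rightarrow> real^'n \<Rightarrow> bool" where
  \<comment> \<open>\<open>tensor_pow1 m A x\<close> is the gradient of \<open>phi m A\<close> at \<open>x\<close> for symmetric \<open>A\<close>\<close>
  "projected_gradient_direction m A x d \<longleftrightarrow> d = - ((mat 1 - outer x x) *v tensor_pow1 m A x)"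

definition regularized_direction ::
    "nat \<Rightarrow> 'n::finite tensor \<Rightarrow> real \<Rightarrow> real^'n \<Rightarrow> real^'n \<Rightarrow> bool" where
  "regularized_direction m A \<mu> x d \<longleftrightarrow>
     (F' m A x ** F' m A x + (\<mu> * norm (F m A x)) *\<^sub>R mat 1) *v d + F' m A x *v F m A x = 0"

text \<open>
  The Newton system may have several solutions. The algorithm may then pick any of them, so
  the fallback is available as soon as some Newton direction is not a curve descent direction.

  A solution of the regularized system need not be a curve descent direction, and an
  unsafeguarded step along it can increase \<open>phi\<close>: take \<open>m = n = 2\<close>, \<open>A = diag(125, 75)\<close>,
  \<open>x = (4/5, 3/5)\<close>, \<open>\<mu> = 1\<close>, \<open>\<sigma> = 1/4\<close>, where the line search accepts the step length 1.
  Since the fallback is meant to supply a curve descent direction, this is required of the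
  regularized direction; the projected gradient direction is one automatically.
\<close>

definition search_direction ::
    "nat \<Rightarrow> 'n::finite tensor \<Rightarrow> (real^'n \<Rightarrow> nat \<Rightarrow> real^'n) \<Rightarrow> real \<Rightarrow> real^'n \<Rightarrow> real^'n \<Rightarrow> bool" where
  "search_direction m A U \<mu> x d \<longleftrightarrow>
     (newton_direction m A U x d \<and> curve_descent (phi m A) x d) \<or>
     ((\<nexists>d'. newton_direction m A U x d') \<or>
      (\<exists>d'. newton_direction m A U x d' \<and> \<not> curve_descent (phi m A) x d')) \<and>
     (projected_gradient_direction m A x d \<or>
      regularized_direction m A \<mu> x d \<and> curve_descent (phi m A) x d)"

definition acceptable_step ::
    "nat \<Rightarrow> 'n::finite tensor \<Rightarrow> real \<Rightarrow> real^'n \<Rightarrow> real^'n \<Rightarrow> real \<Rightarrow> bool" where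
  \<comment> \<open>the first conjunct says that the trial point \<open>curve x d \<alpha>\<close> is a genuine normalization\<close>
  "acceptable_step m A \<sigma> x d \<alpha> \<longleftrightarrow>
     x + \<alpha> *\<^sub>R d \<noteq> 0 \<and> phi m A (curve x d \<alpha>) \<le> phi m A x + \<sigma> * \<alpha> * (F m A x \<bullet> d)"

definition backtracking_step ::
    "nat \<Rightarrow> 'n::finite tensor \<Rightarrow> real \<Rightarrow> real \<Rightarrow> real^'n \<Rightarrow> real^'n \<Rightarrow> real \<Rightarrow> bool" where
  "backtracking_step m A \<sigma> \<rho> x d \<alpha> \<longleftrightarrow>
     (\<exists>j. \<alpha> = \<rho> ^ j \<and> acceptable_step m A \<sigma> x d (\<rho> ^ j) \<and>
          (\<forall>i<j. \<not> acceptable_step m A \<sigma> x d (\<rho> ^ i)))"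

text \<open>
  A complete run of the algorithm performs \<open>N\<close> iterations, where \<open>N = \<infinity>\<close> if it does not terminate.
  The iterates are the \<open>x k\<close> with \<open>k \<le> N\<close>; values of \<open>x\<close>, \<open>d\<close>, \<open>\<alpha>\<close> beyond \<open>N\<close> are irrelevant.
\<close>

definition global_newton_run ::
    "nat \<Rightarrow> 'n::finite tensor \<Rightarrow> (real^'n \<Rightarrow> nat \<Rightarrow> real^'n) \<Rightarrow> real \<Rightarrow> real \<Rightarrow> real \<Rightarrow>
     enat \<Rightarrow> (nat \<Rightarrow> real^'n) \<Rightarrow> (nat \<Rightarrow> real^'n) \<Rightarrow> (nat \<Rightarrow> real) \<Rightarrow> bool" where
  "global_newton_run m A U \<sigma> \<mu> \<rho> N x d \<alpha> \<longleftrightarrow>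
     x 0 \<in> unit_vectors \<and>
     (\<forall>k. enat k < N \<longrightarrow>
        F m A (x k) \<noteq> 0 \<and>
        search_direction m A U \<mu> (x k) (d k) \<and>
        backtracking_step m A \<sigma> \<rho> (x k) (d k) (\<alpha> k) \<and>
        x (Suc k) = curve (x k) (d k) (\<alpha> k)) \<and>
     (\<forall>k. N = enat k \<longrightarrow> F m A (x k) = 0)"

definition accumulation_point :: "(nat \<Rightarrow> 'a::topological_space) \<Rightarrow> 'a \<Rightarrow> bool" where
  "accumulation_point x l \<longleftrightarrow> (\<exists>r. strict_mono (r :: nat \<Rightarrow> nat) \<and> (x \<circ> r) \<longlonglongrightarrow> l)"

end

theory Submission
  imports Defs
begin

text \<open>
  Near a second order sufficient point \<open>xbar\<close> the quadratic form of \<open>F'\<close> is uniformly coercive on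
  tangent spaces. There the Newton direction exists, is unique and satisfies
  \<open>F x \<bullet> d \<le> - c \<parallel>d\<parallel>\<^sup>2\<close>, so the algorithm uses it, and the line search accepts step lengths
  bounded away from 0. As \<open>phi\<close> converges along the iterates, \<open>d\<close> and hence \<open>F\<close> tends to 0 along
  the subsequence converging to \<open>xbar\<close>, so \<open>F xbar = 0\<close>. Then \<open>xbar\<close> is a strict local minimizer of
  \<open>phi\<close> on the sphere; since steps starting close to \<open>xbar\<close> are short and \<open>phi\<close> never increases,
  the iterates cannot leave a small neighbourhood of \<open>xbar\<close>. Hence the whole sequence converges to
  \<open>xbar\<close>, which is its only accumulation point.
\<close>

section \<open>Derivatives of tensor forms\<close>

text \<open>The homogeneous polynomial of degree \<open>k\<close> with coefficient tensor
  \<open>B\<close>. The entries of \<open>tensor_pow1\<close> and \<open>tensor_pow2\<close> are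
  such forms of slices of \<open>A\<close>, so one induction on the degree serves all powers of
  \<open>A\<close>.\<close>

definition tensor_form :: "nat \<Rightarrow> 'n::finite tensor \<Rightarrow> real^'n \<Rightarrow> real" where
  "tensor_form k B x = (\<Sum>is\<in>{is. length is = k}. B is * (\<Prod>i\<leftarrow>is. x $ i))"

lemma tensor_form_0 [simp]: "tensor_form 0 B x = B []"
  by (simp add: tensor_form_def)

lemma tensor_form_Suc:
  "tensor_form (Suc k) B x = (\<Sum>i\<in>UNIV. x $ i * tensor_form k (\<lambda>is. B (i # is)) x)"
proof -
  have eq: "{is :: 'n list. length is = Suc k} = (\<lambda>(i, is). i # is) ` (UNIV \<times> {is. length is = k})"
    by (auto simp: length_Suc_conv image_iff)
  have inj: "inj_on (\<lambda>(i, is). i # is) (UNIV \<times> {is :: 'n list. length is = k})"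
    by (auto simp: inj_on_def)
  show ?thesis
    unfolding tensor_form_def eq
    by (subst sum.reindex[OF inj])
       (simp add: case_prod_unfold sum.cartesian_product' sum_distrib_left mult_ac)
qed

lemma tensor_form_cong:
  assumes "\<And>is. length is = k \<Longrightarrow> B is = C is"
  shows "tensor_form k B x = tensor_form k C x"
  unfolding tensor_form_def by (intro sum.cong) (auto simp: assms)

lemma continuous_on_tensor_form [continuous_intros]:
  fixes B :: "'n::finite tensor"
  assumes "continuous_on S f"
  shows "continuous_on S (\<lambda>x. tensor_form k B (f x))"
  using assms
  by (induction k arbitrary: B) (auto simp: tensor_form_Suc intro!: continuous_intros)

lemma symmetric_tensor_Cons:
  "symmetric_tensor (Suc k) B \<Longrightarrow> symmetric_tensor k (\<lambda>is. B (i # is))"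
  by (auto simp: symmetric_tensor_def)

lemma symmetric_tensor_swap:
  assumes "symmetric_tensor (Suc (Suc k)) B" "length is = k"
  shows "B (i # j # is) = B (j # i # is)"
  using assms by (simp add: symmetric_tensor_def add_mset_commute)

lemmas has_derivative_vec_nth [derivative_intros] =
  bounded_linear.has_derivative[OF bounded_linear_vec_nth]

text \<open>Product rule on the recursion that splits off the first index. Symmetry makes every
  index position contribute the same term, whence the factor \<open>Suc k\<close>.\<close>

lemma has_derivative_tensor_form:
  fixes B :: "'n::finite tensor"
  assumes "symmetric_tensor (Suc k) B"
  shows "(tensor_form (Suc k) B has_derivative
    (\<lambda>h. real (Suc k) * (\<Sum>i\<in>UNIV. h $ i * tensor_form k (\<lambda>is. B (i # is)) x))) (at x)"
  using assms
proof (induction k arbitrary: B)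
  case 0
  show ?case
    by (auto simp: tensor_form_Suc[abs_def] intro!: derivative_eq_intros)
next
  case (Suc k)
  have IH: "(tensor_form (Suc k) (\<lambda>is. B (i # is)) has_derivative
    (\<lambda>h. real (Suc k) * (\<Sum>j\<in>UNIV. h $ j * tensor_form k (\<lambda>is. B (i # j # is)) x))) (at x)" for i
    by (rule Suc.IH) (rule symmetric_tensor_Cons[OF Suc.prems])
  have swap: "tensor_form k (\<lambda>is. B (i # j # is)) x = tensor_form k (\<lambda>is. B (j # i # is)) x" for i j
    by (rule tensor_form_cong) (rule symmetric_tensor_swap[OF Suc.prems])
  \<comment> \<open>The slices contribute \<open>Suc k\<close> copies of the wanted sum once the two
    leading indices are exchanged; the remaining copy comes from differentiating the factor
    \<open>x $ i\<close>.\<close>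
  have "(\<Sum>i\<in>UNIV. x $ i * (real (Suc k) * (\<Sum>j\<in>UNIV. h $ j * tensor_form k (\<lambda>is. B (i # j # is)) x)))
      = real (Suc k) * (\<Sum>j\<in>UNIV. h $ j * tensor_form (Suc k) (\<lambda>is. B (j # is)) x)" for h :: "real^'n"
    unfolding tensor_form_Suc sum_distrib_left
    by (subst sum.swap) (simp add: swap mult_ac)
  then show ?case
    unfolding tensor_form_Suc[of "Suc k" B, abs_def]
    by (auto intro!: derivative_eq_intros IH simp: sum.distrib algebra_simps)
qed

section \<open>Continuity and derivatives of the powers of \<open>A\<close>\<close>

lemma tensor_pow1_eq: "tensor_pow1 m A x = (\<chi> i. tensor_form (m - 1) (\<lambda>is. A (i # is)) x)"
  by (simp add: tensor_pow1_def tensor_form_def)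

lemma tensor_pow2_eq: "tensor_pow2 m A x = (\<chi> i j. tensor_form (m - 2) (\<lambda>is. A (i # j # is)) x)"
  by (simp add: tensor_pow2_def tensor_form_def)

lemma tensor_pow_eq: "m \<ge> 1 \<Longrightarrow> tensor_pow m A x = tensor_form m A x"
  by (cases m) (auto simp: tensor_pow_def tensor_pow1_eq tensor_form_Suc inner_vec_def)

lemma continuous_on_tensor_pow1 [continuous_intros]:
  "continuous_on S f \<Longrightarrow> continuous_on S (\<lambda>x. tensor_pow1 m A (f x))"
  unfolding tensor_pow1_eq by (intro continuous_intros)

lemma continuous_on_tensor_pow [continuous_intros]:
  "continuous_on S f \<Longrightarrow> continuous_on S (\<lambda>x. tensor_pow m A (f x))"
  unfolding tensor_pow_def by (intro continuous_intros)

lemma continuous_on_phi [continuous_intros]: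
  "continuous_on S f \<Longrightarrow> continuous_on S (\<lambda>x. phi m A (f x))"
  \<comment> \<open>For \<open>m = 0\<close> division by zero makes \<open>phi\<close> constantly
    0.\<close>
  unfolding phi_def by (cases "m = 0") (auto intro!: continuous_intros)

lemma continuous_on_F [continuous_intros]:
  "continuous_on S f \<Longrightarrow> continuous_on S (\<lambda>x. F m A (f x))"
  unfolding F_def by (intro continuous_intros)

lemma continuous_on_F'_vec [continuous_intros]:
  assumes "continuous_on S f" "continuous_on S g"
  shows "continuous_on S (\<lambda>x. F' m A (f x) *v g x)"
  unfolding F'_def outer_def tensor_pow2_eq matrix_vector_mult_def
  using assms by (auto intro!: continuous_intros)

lemma has_derivative_phi:
  assumes "m \<ge> 1" "symmetric_tensor m A"
  shows "(phi m A has_derivative (\<lambda>h. tensor_pow1 m A x \<bullet> h)) (at x)"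
proof -
  obtain k where m: "m = Suc k"
    using assms(1) by (cases m) auto
  have "phi m A = (\<lambda>x. tensor_form (Suc k) A x / real m)"
    using assms(1) by (simp add: phi_def[abs_def] tensor_pow_eq m)
  then show ?thesis
    using has_derivative_tensor_form[of k A x] assms
    by (auto intro!: derivative_eq_intros simp: m tensor_pow1_eq inner_vec_def mult.commute)
qed

lemma has_derivative_tensor_pow1:
  assumes "m \<ge> 2" "symmetric_tensor m A"
  shows "(tensor_pow1 m A has_derivative (\<lambda>h. (real m - 1) *\<^sub>R (tensor_pow2 m A x *v h))) (at x)"
proof -
  obtain k where m: "m = Suc (Suc k)"
    using assms(1) by (metis add_2_eq_Suc le_Suc_ex)
  have "(tensor_form (Suc k) (\<lambda>is. A (i # is)) has_derivative
     (\<lambda>h. ((real m - 1) *\<^sub>R (tensor_pow2 m A x *v h)) $ i)) (at x)" for i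
    by (rule has_derivative_eq_rhs[OF has_derivative_tensor_form])
       (use assms(2) in \<open>auto simp: m tensor_pow2_eq matrix_vector_mult_def mult.commute
          intro: symmetric_tensor_Cons\<close>)
  then show ?thesis
    unfolding tensor_pow1_eq[abs_def]
    by (subst has_derivative_componentwise_within)
       (auto simp: Basis_vec_def inner_axis m)
qed

lemma gradient_mean_value:
  fixes f :: "'a::real_inner \<Rightarrow> real"
  assumes "\<And>z. (f has_derivative (\<lambda>h. g z \<bullet> h)) (at z)"
  obtains t where "0 < t" "t < 1" "f y - f x = g (x + t *\<^sub>R (y - x)) \<bullet> (y - x)"
proof -
  have "((\<lambda>t. f (x + t *\<^sub>R (y - x))) has_real_derivative
      g (x + t *\<^sub>R (y - x)) \<bullet> (y - x)) (at t)" for t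
    unfolding has_field_derivative_def
    by (rule has_derivative_eq_rhs[OF has_derivative_compose[OF _ assms]])
       (auto intro!: derivative_eq_intros)
  from MVT2[OF zero_less_one this] that show ?thesis
    by auto
qed

lemma tensor_pow1_lipschitz_on_cball:
  assumes "m \<ge> 2" "symmetric_tensor m A"
  obtains L where "L \<ge> 0"
    "\<And>x y. x \<in> cball 0 1 \<Longrightarrow> y \<in> cball 0 1 \<Longrightarrow>
       norm (tensor_pow1 m A x - tensor_pow1 m A y) \<le> L * norm (x - y)"
proof -
  let ?D = "\<lambda>x. (real m - 1) *\<^sub>R tensor_pow2 m A x"
  \<comment> \<open>The sum of the absolute entries bounds the operator norm of the derivative and
    is continuous, so its bound on the compact convex ball is a Lipschitz constant.\<close>
  let ?s = "\<lambda>x. \<Sum>i\<in>UNIV. \<Sum>j\<in>UNIV. \<bar>?D x $ i $ j\<bar>"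
  have "continuous_on (cball 0 1) ?s"
    unfolding tensor_pow2_eq by (simp, intro continuous_intros)
  then have "bounded (?s ` cball 0 1)"
    by (intro compact_imp_bounded compact_continuous_image compact_cball)
  then obtain L where "L > 0" and L: "\<And>x. x \<in> cball 0 1 \<Longrightarrow> norm (?s x) \<le> L"
    unfolding bounded_pos by blast
  have "norm (tensor_pow1 m A x - tensor_pow1 m A y) \<le> L * norm (x - y)"
    if "x \<in> cball 0 1" "y \<in> cball 0 1" for x y
  proof (rule differentiable_bound[of "cball 0 1"])
    fix z :: "real^'a"
    assume z: "z \<in> cball 0 1"
    show "(tensor_pow1 m A has_derivative (*v) (?D z)) (at z within cball 0 1)"
      using has_derivative_tensor_pow1[OF assms, of z]
      by (simp add: has_derivative_at_withinI scaleR_matrix_vector_assoc)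
    show "onorm ((*v) (?D z)) \<le> L"
      using onorm_le_matrix_component_sum[of "?D z"] L[OF z] by simp
  qed (use that in auto)
  with \<open>L > 0\<close> show ?thesis
    by (intro that[of L]) auto
qed

section \<open>The normalized curves\<close>

lemma inner_F_self: "x \<bullet> x = 1 \<Longrightarrow> x \<bullet> F m A x = 0"
  by (simp add: F_def tensor_pow_def inner_diff_right)

lemma inner_F_tangent: "x \<bullet> d = 0 \<Longrightarrow> F m A x \<bullet> d = tensor_pow1 m A x \<bullet> d"
  by (simp add: F_def inner_diff_left)

lemma Z_eigenpair_iff_F: "Z_eigenpair m A x (tensor_pow m A x) \<longleftrightarrow> F m A x = 0 \<and> x \<bullet> x = 1"
  by (simp add: Z_eigenpair_def F_def)

lemma outer_mult_vec: "outer x y *v d = (y \<bullet> d) *\<^sub>R x"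
  by (simp add: outer_def matrix_vector_mult_def vec_eq_iff inner_vec_def sum_distrib_left mult_ac)

text \<open>A tangent \<open>u\<close> annihilates the rank-one term of \<open>F'\<close>. For
  symmetric \<open>A\<close> the rest is the form of the Riemannian Hessian of \<open>phi\<close> on
  the sphere.\<close>

lemma inner_F'_tangent:
  assumes "x \<bullet> u = 0"
  shows "u \<bullet> (F' m A x *v d) =
    (real m - 1) * (u \<bullet> (tensor_pow2 m A x *v d)) - tensor_pow m A x * (u \<bullet> d)"
  using assms
  by (simp add: F'_def matrix_vector_mult_diff_rdistrib scaleR_matrix_vector_assoc[symmetric]
      outer_mult_vec inner_diff_right inner_commute)

lemma curve_unit: "x + \<alpha> *\<^sub>R d \<noteq> 0 \<Longrightarrow> curve x d \<alpha> \<bullet> curve x d \<alpha> = 1"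
  by (simp add: curve_def power2_norm_eq_inner[symmetric])

lemma curve_0: "x \<bullet> x = 1 \<Longrightarrow> curve x d 0 = x"
  by (simp add: curve_def norm_eq_sqrt_inner)

text \<open>Pythagoras. The excess over 1 is quadratic in the step length, so normalization does not
  disturb the first order behaviour of \<open>phi\<close> along the curve.\<close>

lemma norm_tangent_step:
  assumes "x \<bullet> x = 1" "x \<bullet> d = 0"
  shows "1 \<le> norm (x + \<alpha> *\<^sub>R d)" "norm (x + \<alpha> *\<^sub>R d) \<le> 1 + \<alpha>\<^sup>2 * (d \<bullet> d) / 2"
proof -
  define r where "r = norm (x + \<alpha> *\<^sub>R d)"
  have "r\<^sup>2 = 1 + \<alpha>\<^sup>2 * (d \<bullet> d)"
    unfolding r_def power2_norm_eq_inner using assms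
    by (simp add: inner_add_left inner_add_right inner_commute[of d x] power2_eq_square)
  moreover have "0 \<le> \<alpha>\<^sup>2 * (d \<bullet> d)"
    by simp
  ultimately have *: "1 \<le> r\<^sup>2" "r\<^sup>2 = 1 + \<alpha>\<^sup>2 * (d \<bullet> d)"
    by simp_all
  have "r \<ge> 0"
    by (simp add: r_def)
  with * show "1 \<le> norm (x + \<alpha> *\<^sub>R d)"
    unfolding r_def[symmetric] using power2_le_imp_le[of 1 r] by simp
  \<comment> \<open>Equivalently \<open>r \<le> (r\<^sup>2 + 1) / 2\<close>, which avoids estimating
    a square root.\<close>
  have "0 \<le> (r - 1)\<^sup>2"
    by simp
  with * show "norm (x + \<alpha> *\<^sub>R d) \<le> 1 + \<alpha>\<^sup>2 * (d \<bullet> d) / 2"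
    unfolding r_def[symmetric] by (simp add: power2_diff)
qed

lemma tangent_step_nonzero: "x \<bullet> x = 1 \<Longrightarrow> x \<bullet> d = 0 \<Longrightarrow> x + \<alpha> *\<^sub>R d \<noteq> 0"
  using norm_tangent_step(1)[of x d \<alpha>] by auto

text \<open>The tangential move and the radial move back to the sphere each have length at most
  \<open>norm (\<alpha> *\<^sub>R d)\<close>.\<close>

lemma norm_curve_minus:
  assumes "x \<bullet> x = 1" "x \<bullet> d = 0"
  shows "norm (curve x d \<alpha> - x) \<le> 2 * norm (\<alpha> *\<^sub>R d)"
proof -
  define v where "v = x + \<alpha> *\<^sub>R d"
  have "norm x = 1"
    using assms by (simp add: norm_eq_1)
  have v: "1 \<le> norm v" "norm v \<le> 1 + norm (\<alpha> *\<^sub>R d)"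
    using norm_tangent_step(1)[OF assms] norm_triangle_ineq[of x "\<alpha> *\<^sub>R d"] \<open>norm x = 1\<close>
    by (simp_all add: v_def)
  have "norm (v /\<^sub>R norm v - v) = norm ((inverse (norm v) - 1) *\<^sub>R v)"
    by (simp add: scaleR_left_diff_distrib)
  also have "\<dots> = norm v - 1"
    using v(1) unfolding norm_scaleR by (auto simp: abs_if field_simps)
  finally have "norm (v /\<^sub>R norm v - v) = norm v - 1" .
  moreover have "norm (curve x d \<alpha> - x) \<le> norm (v /\<^sub>R norm v - v) + norm (\<alpha> *\<^sub>R d)"
    using norm_triangle_ineq[of "v /\<^sub>R norm v - v" "\<alpha> *\<^sub>R d"] by (simp add: curve_def v_def)
  ultimately show ?thesis
    using v(2) by simp
qed

section \<open>Variation of \<open>phi\<close> along the curves\<close>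

lemma has_real_derivative_phi_curve:
  assumes "m \<ge> 1" "symmetric_tensor m A" "x \<bullet> x = 1"
  shows "((\<lambda>\<alpha>. phi m A (curve x d \<alpha>)) has_real_derivative F m A x \<bullet> d) (at 0)"
proof -
  have [simp]: "norm x = 1"
    using assms by (simp add: norm_eq_1)
  have [simp]: "sgn x = x"
    by (simp add: sgn_div_norm)
  have "x \<noteq> 0"
    using assms(3) by auto
  have n: "((\<lambda>\<alpha>. norm (x + \<alpha> *\<^sub>R d)) has_derivative (\<lambda>h. h * (x \<bullet> d))) (at 0)"
    by (rule has_derivative_eq_rhs[OF has_derivative_compose[OF _ has_derivative_norm]])
       (use \<open>x \<noteq> 0\<close> in \<open>auto intro!: derivative_eq_intros simp: inner_commute\<close>)
  \<comment> \<open>The velocity at 0 is the projection of \<open>d\<close> onto the orthogonal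
    complement of \<open>x\<close>. This also covers directions that are not tangent, as
    \<open>regularized_direction\<close> imposes no tangency.\<close>
  have c: "(curve x d has_derivative (\<lambda>h. h *\<^sub>R d - (h * (x \<bullet> d)) *\<^sub>R x)) (at 0)"
    unfolding curve_def[abs_def]
    by (rule has_derivative_eq_rhs[OF has_derivative_scaleR[OF has_derivative_compose[OF n
          has_derivative_inverse'] has_derivative_add[OF has_derivative_const
          has_derivative_scaleR[OF has_derivative_ident has_derivative_const]]]])
       (auto simp: fun_eq_iff)
  have "curve x d 0 = x"
    by (rule curve_0) fact
  with has_derivative_compose[OF c has_derivative_phi[OF assms(1,2)]]
  have "((\<lambda>\<alpha>. phi m A (curve x d \<alpha>)) has_derivative
      (\<lambda>h. tensor_pow1 m A x \<bullet> (h *\<^sub>R d - (h * (x \<bullet> d)) *\<^sub>R x))) (at 0)"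
    by simp
  then show ?thesis
    unfolding has_field_derivative_def
    by (rule has_derivative_eq_rhs)
       (simp add: fun_eq_iff F_def tensor_pow_def inner_diff_left inner_diff_right algebra_simps
          inner_commute[of x "tensor_pow1 m A x"])
qed

text \<open>A positive derivative at 0 would make \<open>phi\<close> increase for small steps. The
  inequality is weak because descent along a curve may be an effect of higher order.\<close>

lemma curve_descent_imp_nonpos:
  assumes "m \<ge> 1" "symmetric_tensor m A" "x \<bullet> x = 1" "curve_descent (phi m A) x d"
  shows "F m A x \<bullet> d \<le> 0"
proof (rule ccontr)
  assume "\<not> F m A x \<bullet> d \<le> 0"
  then obtain \<delta> where "\<delta> > 0"
    and \<delta>: "\<And>h. 0 < h \<Longrightarrow> h < \<delta> \<Longrightarrow> phi m A (curve x d 0) < phi m A (curve x d h)"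
    using DERIV_pos_inc_right[OF has_real_derivative_phi_curve[OF assms(1-3), of d]]
    by (auto simp: not_le)
  from assms(4) obtain b where "b > 0"
    and b: "\<And>h. 0 < h \<Longrightarrow> h < b \<Longrightarrow> phi m A (curve x d h) < phi m A x"
    unfolding curve_descent_def eventually_at_right_field by blast
  have "curve x d 0 = x"
    by (rule curve_0) fact
  moreover have "0 < min \<delta> b / 2" "min \<delta> b / 2 < \<delta>" "min \<delta> b / 2 < b"
    using \<open>\<delta> > 0\<close> \<open>b > 0\<close> by linarith+
  ultimately show False
    using \<delta> b by (metis less_asym)
qed

lemma neg_imp_curve_descent:
  assumes "m \<ge> 1" "symmetric_tensor m A" "x \<bullet> x = 1" "F m A x \<bullet> d < 0"
  shows "curve_descent (phi m A) x d"
proof -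
  have "curve x d 0 = x"
    by (rule curve_0) fact
  with DERIV_neg_dec_right[OF has_real_derivative_phi_curve[OF assms(1-3)] assms(4)]
  show ?thesis
    unfolding curve_descent_def eventually_at_right_field by auto
qed

text \<open>The descent lemma on the sphere, with \<open>C\<close> uniform in the point, the
  direction and the step length. The Lipschitz constant of the gradient controls the change along
  the chord; its bound \<open>G\<close> controls the normalization error.\<close>

lemma phi_curve_le:
  assumes "m \<ge> 2" "symmetric_tensor m A"
  obtains C where "C > 0"
    "\<And>x d \<alpha>. x \<bullet> x = 1 \<Longrightarrow> x \<bullet> d = 0 \<Longrightarrow>
       phi m A (curve x d \<alpha>) \<le> phi m A x + \<alpha> * (F m A x \<bullet> d) + C * \<alpha>\<^sup>2 * (d \<bullet> d)"
proof -
  have "m \<ge> 1"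
    using assms by simp
  obtain L where L: "L \<ge> 0"
    "\<And>x y. x \<in> cball 0 1 \<Longrightarrow> y \<in> cball 0 1 \<Longrightarrow>
       norm (tensor_pow1 m A x - tensor_pow1 m A y) \<le> L * norm (x - y)"
    using tensor_pow1_lipschitz_on_cball[OF assms] by metis
  have "bounded (tensor_pow1 m A ` cball 0 1)"
    by (intro compact_imp_bounded compact_continuous_image compact_cball continuous_intros)
  then obtain G where "G > 0" and G: "\<And>x. x \<in> cball 0 1 \<Longrightarrow> norm (tensor_pow1 m A x) \<le> G"
    unfolding bounded_pos by blast
  have "phi m A (curve x d \<alpha>) \<le> phi m A x + \<alpha> * (F m A x \<bullet> d) + (G + 4 * L) * \<alpha>\<^sup>2 * (d \<bullet> d)"
    if x: "x \<bullet> x = 1" and d: "x \<bullet> d = 0" for x d :: "real^'a" and \<alpha>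
  proof -
    define r where "r = norm (x + \<alpha> *\<^sub>R d)"
    define y where "y = curve x d \<alpha>"
    define g where "g = tensor_pow1 m A x"
    have "r \<ge> 1" and r: "r \<le> 1 + \<alpha>\<^sup>2 * (d \<bullet> d) / 2"
      using norm_tangent_step[OF x d] by (simp_all add: r_def)
    have xB: "x \<in> cball 0 1"
      using x by (simp add: norm_eq_1[symmetric])
    have yB: "y \<in> cball 0 1"
      using curve_unit[OF tangent_step_nonzero[OF x d]] by (simp add: norm_eq_1[symmetric] y_def)
    obtain t where t: "0 < t" "t < 1"
      "phi m A y - phi m A x = tensor_pow1 m A (x + t *\<^sub>R (y - x)) \<bullet> (y - x)"
      using gradient_mean_value[OF has_derivative_phi[OF \<open>m \<ge> 1\<close> assms(2)]] by blast
    define z where "z = x + t *\<^sub>R (y - x)"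
    \<comment> \<open>The intermediate point lies on the chord, hence in the ball, where the
      Lipschitz estimate is available.\<close>
    have "z = (1 - t) *\<^sub>R x + t *\<^sub>R y"
      by (simp add: z_def algebra_simps)
    then have zB: "z \<in> cball 0 1"
      using t convexD[OF convex_cball xB yB, of "1 - t" t] by simp
    have ynorm: "norm (y - x) \<le> 2 * norm (\<alpha> *\<^sub>R d)"
      unfolding y_def by (rule norm_curve_minus[OF x d])
    have "(tensor_pow1 m A z - g) \<bullet> (y - x) \<le> norm (tensor_pow1 m A z - g) * norm (y - x)"
      by (rule norm_cauchy_schwarz)
    also have "\<dots> \<le> (L * norm (z - x)) * norm (y - x)"
      unfolding g_def by (intro mult_right_mono L zB xB) auto
    also have "\<dots> \<le> (L * norm (y - x)) * norm (y - x)"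
      using t L(1) by (intro mult_right_mono mult_left_mono) (auto simp: z_def mult_left_le_one_le)
    also have "\<dots> = L * (norm (y - x))\<^sup>2"
      by (simp add: power2_eq_square)
    also have "\<dots> \<le> L * (2 * norm (\<alpha> *\<^sub>R d))\<^sup>2"
      using L(1) ynorm by (intro mult_left_mono power_mono) auto
    also have "\<dots> = 4 * L * \<alpha>\<^sup>2 * (d \<bullet> d)"
      by (simp add: power_mult_distrib power2_norm_eq_inner)
    finally have 1: "(tensor_pow1 m A z - g) \<bullet> (y - x) \<le> 4 * L * \<alpha>\<^sup>2 * (d \<bullet> d)" .
    \<comment> \<open>Since \<open>r *\<^sub>R y = x + \<alpha> *\<^sub>R d\<close>, the chord is
      the tangent step plus a radial correction of second order.\<close>
    have "y - x = \<alpha> *\<^sub>R d + (1 - r) *\<^sub>R y"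
      using \<open>r \<ge> 1\<close> by (simp add: y_def curve_def r_def[symmetric] algebra_simps)
    then have "g \<bullet> (y - x) = \<alpha> * (F m A x \<bullet> d) + (1 - r) * (g \<bullet> y)"
      by (simp add: inner_F_tangent[OF d] g_def inner_simps)
    moreover have "(1 - r) * (g \<bullet> y) \<le> G * \<alpha>\<^sup>2 * (d \<bullet> d)"
    proof -
      have "(1 - r) * (g \<bullet> y) \<le> (r - 1) * \<bar>g \<bullet> y\<bar>"
        using mult_left_mono[of "- (g \<bullet> y)" "\<bar>g \<bullet> y\<bar>" "r - 1"] \<open>r \<ge> 1\<close> by (simp add: algebra_simps)
      also have "\<dots> \<le> (r - 1) * (norm g * norm y)"
        using \<open>r \<ge> 1\<close> by (intro mult_left_mono Cauchy_Schwarz_ineq2) auto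
      also have "\<dots> \<le> (\<alpha>\<^sup>2 * (d \<bullet> d)) * (G * 1)"
        using r G[OF xB] yB \<open>r \<ge> 1\<close> \<open>G > 0\<close> zero_le_power2[of \<alpha>] inner_ge_zero[of d]
        by (intro mult_mono) (auto simp: g_def)
      finally show ?thesis
        by (simp add: mult_ac)
    qed
    moreover have "phi m A y - phi m A x = g \<bullet> (y - x) + (tensor_pow1 m A z - g) \<bullet> (y - x)"
      using t(3) by (simp add: z_def inner_diff_left)
    ultimately show ?thesis
      using 1 by (simp add: y_def algebra_simps)
  qed
  with \<open>G > 0\<close> \<open>L \<ge> 0\<close> show ?thesis
    by (intro that[of "G + 4 * L"]) auto
qed

section \<open>Newton steps near a second order sufficient point\<close>

text \<open>A quantitative second order condition free of the basis. The choice \<open>U\<close>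
  need not depend continuously on the point, whereas this condition can be carried to nearby
  points.\<close>

definition tangent_coercive :: "nat \<Rightarrow> 'n::finite tensor \<Rightarrow> real \<Rightarrow> real^'n \<Rightarrow> bool" where
  "tangent_coercive m A c x \<longleftrightarrow> (\<forall>d. x \<bullet> d = 0 \<longrightarrow> c * (d \<bullet> d) \<le> d \<bullet> (F' m A x *v d))"

lemma tangent_coerciveD:
  "tangent_coercive m A c x \<Longrightarrow> x \<bullet> d = 0 \<Longrightarrow> c * (d \<bullet> d) \<le> d \<bullet> (F' m A x *v d)"
  by (simp add: tangent_coercive_def)

lemma perp_basis_coefficients:
  fixes x :: "real^'n"
  assumes "perp_basis x U" "x \<bullet> d = 0"
  obtains z where "d = (\<Sum>i<CARD('n) - 1. z i *\<^sub>R U i)"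
proof -
  let ?J = "{..<CARD('n) - 1}"
  have U: "inj_on U ?J" "span (U ` ?J) = {d. x \<bullet> d = 0}"
    using assms(1) by (simp_all add: perp_basis_def Let_def)
  then have "d \<in> span (U ` ?J)"
    using assms(2) by simp
  then obtain u where "d = (\<Sum>v\<in>U ` ?J. u v *\<^sub>R v)"
    by (auto simp: span_finite)
  then have "d = (\<Sum>i<CARD('n) - 1. u (U i) *\<^sub>R U i)"
    using sum.reindex[OF U(1), of "\<lambda>v. u v *\<^sub>R v"] by (simp only: o_def)
  then show ?thesis
    by (rule that)
qed

lemma perp_basis_orthogonal:
  fixes x :: "real^'n"
  assumes "perp_basis x U" "i < CARD('n) - 1"
  shows "x \<bullet> U i = 0"
proof -
  have "U i \<in> span (U ` {..<CARD('n) - 1})"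
    using assms(2) by (intro span_base) auto
  then show ?thesis
    using assms(1) by (simp add: perp_basis_def Let_def)
qed

lemma second_order_sufficient_imp_pos:
  fixes x :: "real^'n::finite"
  assumes "perp_basis x (U x)" "second_order_sufficient m A U x" "x \<bullet> d = 0" "d \<noteq> 0"
  shows "0 < d \<bullet> (F' m A x *v d)"
proof -
  obtain z where z: "d = (\<Sum>i<CARD('n) - 1. z i *\<^sub>R U x i)"
    using perp_basis_coefficients[OF assms(1,3)] .
  have "\<exists>i<CARD('n) - 1. z i \<noteq> 0"
  proof (rule ccontr)
    assume "\<not> ?thesis"
    then have "d = 0"
      unfolding z by (intro sum.neutral) auto
    with \<open>d \<noteq> 0\<close> show False ..
  qed
  moreover have "d \<bullet> (F' m A x *v d) =
      (\<Sum>i<CARD('n) - 1. \<Sum>j<CARD('n) - 1. z i * (U x i \<bullet> (F' m A x *v U x j)) * z j)"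
    unfolding z
    by (simp add: linear_sum[OF matrix_vector_mul_linear] matrix_vector_mult_scaleR
          inner_sum_left inner_sum_right sum_distrib_left,
        subst sum.swap, simp add: mult_ac)
  ultimately show ?thesis
    using assms(2) unfolding second_order_sufficient_def positive_definite_def by auto
qed

text \<open>Compactness: otherwise there are points \<open>y n\<close> tending to \<open>x\<close>
  with unit tangent vectors whose forms are at most \<open>inverse (real (Suc n))\<close>. A limit
  vector is a unit tangent vector at \<open>x\<close> with nonpositive form.\<close>

lemma second_order_sufficient_imp_coercive_nearby:
  fixes x :: "real^'n::finite"
  assumes "x \<bullet> x = 1" "perp_basis x (U x)" "second_order_sufficient m A U x"
  obtains c e where "c > 0" "e > 0"
    "\<And>y. y \<bullet> y = 1 \<Longrightarrow> dist y x < e \<Longrightarrow> tangent_coercive m A c y"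
proof -
  \<comment> \<open>One number serves as coercivity constant and as radius, so the negation yields a
    single sequence of counterexamples.\<close>
  have "\<exists>c>0. \<forall>y. y \<bullet> y = 1 \<longrightarrow> dist y x < c \<longrightarrow> tangent_coercive m A c y"
  proof (rule ccontr)
    assume "\<not> ?thesis"
    then have "\<exists>y. y \<bullet> y = 1 \<and> dist y x < c \<and> \<not> tangent_coercive m A c y" if "c > 0" for c
      using that by blast
    then have "\<exists>y. y \<bullet> y = 1 \<and> dist y x < inverse (real (Suc n)) \<and>
        \<not> tangent_coercive m A (inverse (real (Suc n))) y" for n
      by simp
    then obtain y where y: "\<And>n. dist (y n) x < inverse (real (Suc n))"
      "\<And>n. \<not> tangent_coercive m A (inverse (real (Suc n))) (y n)"
      by metis
    have "\<exists>d. norm d = 1 \<and> y n \<bullet> d = 0 \<and>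
        d \<bullet> (F' m A (y n) *v d) \<le> inverse (real (Suc n))" for n
    proof -
      obtain d where d: "y n \<bullet> d = 0" "d \<bullet> (F' m A (y n) *v d) < inverse (real (Suc n)) * (d \<bullet> d)"
        using y(2)[of n] by (auto simp: tangent_coercive_def not_le)
      then have "d \<noteq> 0"
        by auto
      have "sgn d \<bullet> (F' m A (y n) *v sgn d) = (d \<bullet> (F' m A (y n) *v d)) / (norm d)\<^sup>2"
        by (simp add: sgn_div_norm matrix_vector_mult_scaleR divide_simps power2_eq_square)
      also have "\<dots> \<le> inverse (real (Suc n))"
        using d(2) \<open>d \<noteq> 0\<close> by (simp add: divide_le_eq power2_norm_eq_inner)
      finally show ?thesis
        using d(1) \<open>d \<noteq> 0\<close> by (intro exI[of _ "sgn d"]) (auto simp: norm_sgn sgn_div_norm)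
    qed
    then obtain d where d: "\<And>n. norm (d n) = 1" "\<And>n. y n \<bullet> d n = 0"
      "\<And>n. d n \<bullet> (F' m A (y n) *v d n) \<le> inverse (real (Suc n))"
      by metis
    have "\<forall>n. d n \<in> sphere 0 1"
      using d(1) by simp
    then obtain l r where l: "l \<in> sphere 0 1" and r: "strict_mono (r :: nat \<Rightarrow> nat)"
      and dl: "(d \<circ> r) \<longlonglongrightarrow> l"
      using compact_sphere[of "0 :: real^'n" 1] unfolding compact_def by metis
    have "y \<longlonglongrightarrow> x"
      by (rule tendstoI, rule eventually_mono[OF order_tendstoD(2)[OF LIMSEQ_inverse_real_of_nat]])
         (auto intro: less_trans[OF y(1)])
    then have yx: "(y \<circ> r) \<longlonglongrightarrow> x"
      by (rule LIMSEQ_subseq_LIMSEQ[OF _ r])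
    have "(\<lambda>n. (y \<circ> r) n \<bullet> (d \<circ> r) n) \<longlonglongrightarrow> x \<bullet> l"
      by (intro tendsto_inner yx dl)
    then have "x \<bullet> l = 0"
      by (simp add: d(2) LIMSEQ_const_iff)
    have "continuous_on UNIV (\<lambda>p. snd p \<bullet> (F' m A (fst p) *v snd p))"
      by (intro continuous_intros)
    from continuous_on_tendsto_compose[OF this tendsto_Pair[OF yx dl]]
    have "(\<lambda>n. (d \<circ> r) n \<bullet> (F' m A ((y \<circ> r) n) *v (d \<circ> r) n)) \<longlonglongrightarrow> l \<bullet> (F' m A x *v l)"
      by simp
    moreover have "(\<lambda>n. inverse (real (Suc (r n)))) \<longlonglongrightarrow> 0"
      using LIMSEQ_subseq_LIMSEQ[OF LIMSEQ_inverse_real_of_nat r] by (simp add: o_def)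
    ultimately have "l \<bullet> (F' m A x *v l) \<le> 0"
      by (rule LIMSEQ_le) (use d(3) in auto)
    moreover have "l \<noteq> 0"
      using l by auto
    ultimately show False
      using second_order_sufficient_imp_pos[OF assms(2,3) \<open>x \<bullet> l = 0\<close>] by simp
  qed
  then show ?thesis
    using that by metis
qed

section \<open>Existence and estimates of Newton directions\<close>

lemma newton_direction_iff:
  fixes x :: "real^'n::finite"
  assumes "perp_basis x (U x)"
  shows "newton_direction m A U x d \<longleftrightarrow>
    x \<bullet> d = 0 \<and> (\<forall>u. x \<bullet> u = 0 \<longrightarrow> u \<bullet> (F' m A x *v d) = - (u \<bullet> F m A x))"
proof (intro iffI conjI allI impI)
  assume N: "newton_direction m A U x d"
  then show "x \<bullet> d = 0"
    by (simp add: newton_direction_def)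
  fix u
  assume "x \<bullet> u = 0"
  then obtain z where z: "u = (\<Sum>i<CARD('n) - 1. z i *\<^sub>R U x i)"
    using perp_basis_coefficients[OF assms] by blast
  have "u \<bullet> (F' m A x *v d) + u \<bullet> F m A x =
      (\<Sum>i<CARD('n) - 1. z i * (U x i \<bullet> (F' m A x *v d) + U x i \<bullet> F m A x))"
    by (simp add: z inner_sum_left sum.distrib algebra_simps)
  also have "\<dots> = 0"
    using N by (intro sum.neutral) (auto simp: newton_direction_def)
  finally show "u \<bullet> (F' m A x *v d) = - (u \<bullet> F m A x)"
    by simp
qed (auto simp: newton_direction_def perp_basis_orthogonal[OF assms])

text \<open>Coercivity makes the projected operator injective on the tangent space. Extending it to
  an endomorphism of the whole space turns injectivity into surjectivity.\<close>

lemma newton_direction_exists: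
  fixes x :: "real^'n::finite"
  assumes "x \<bullet> x = 1" "perp_basis x (U x)" "c > 0" "tangent_coercive m A c x"
  shows "\<exists>d. newton_direction m A U x d"
proof -
  define P where "P v = v - (x \<bullet> v) *\<^sub>R x" for v :: "real^'n"
  have P: "x \<bullet> P v = 0" "x \<bullet> v = 0 \<Longrightarrow> P v = v" for v
    using assms(1) by (simp_all add: P_def inner_diff_right)
  \<comment> \<open>\<open>L\<close> is the projected \<open>F' m A x\<close> on tangent vectors and
    the identity on multiples of \<open>x\<close>. It preserves the \<open>x\<close>-component, so
    its kernel and the preimages of tangent vectors are tangent.\<close>
  define L where "L v = P (F' m A x *v P v) + (x \<bullet> v) *\<^sub>R x" for v
  have xL: "x \<bullet> L v = x \<bullet> v" for v
    using assms(1) by (simp add: L_def inner_add_right P)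
  have uL: "u \<bullet> L v = u \<bullet> (F' m A x *v v)" if "x \<bullet> u = 0" "x \<bullet> v = 0" for u v
    using that by (simp add: L_def P_def inner_diff_right inner_add_right inner_commute[of u x])
  have "linear L"
    by (rule linearI)
       (simp_all add: L_def P_def matrix_vector_mult_diff_distrib matrix_vector_right_distrib
          matrix_vector_mult_scaleR algebra_simps)
  moreover have "inj L"
    unfolding linear_injective_0[OF \<open>linear L\<close>]
  proof (intro allI impI)
    fix v
    assume "L v = 0"
    with xL[of v] have v: "x \<bullet> v = 0"
      by simp
    with uL[OF v v] \<open>L v = 0\<close> have "c * (v \<bullet> v) \<le> 0"
      using assms(4) by (auto simp: tangent_coercive_def)
    with \<open>c > 0\<close> show "v = 0"
      by (metis inner_eq_zero_iff inner_ge_zero mult_le_0_iff not_le order_antisym)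
  qed
  ultimately have "surj L"
    by (rule linear_inj_imp_surj)
  then obtain d where d: "L d = - F m A x"
    by (metis surjD)
  then have xd: "x \<bullet> d = 0"
    using xL[of d] inner_F_self[OF assms(1)] by simp
  with d uL[of _ d] show ?thesis
    unfolding newton_direction_iff[where U = U, OF assms(2)] by (metis inner_minus_right)
qed

text \<open>The Newton equation tested with \<open>d\<close> gives the second estimate, and
  Cauchy-Schwarz then gives the third. Tested with the tangent vector \<open>F m A x\<close> it
  gives the last, by which small \<open>d\<close> forces small \<open>F m A x\<close>.\<close>

lemma newton_direction_estimates:
  fixes x :: "real^'n::finite"
  assumes "x \<bullet> x = 1" "perp_basis x (U x)" "tangent_coercive m A c x" "newton_direction m A U x d"
  shows "x \<bullet> d = 0"
    and "c * (d \<bullet> d) \<le> - (F m A x \<bullet> d)"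
    and "c * norm d \<le> norm (F m A x)"
    and "F m A x \<bullet> F m A x = - (F m A x \<bullet> (F' m A x *v d))"
proof -
  have d: "x \<bullet> d = 0" "\<And>u. x \<bullet> u = 0 \<Longrightarrow> u \<bullet> (F' m A x *v d) = - (u \<bullet> F m A x)"
    using assms(4) by (simp_all add: newton_direction_iff[where U = U, OF assms(2)])
  show "x \<bullet> d = 0"
    by fact
  show est: "c * (d \<bullet> d) \<le> - (F m A x \<bullet> d)"
    using tangent_coerciveD[OF assms(3) d(1)] d(2)[OF d(1)] by (simp add: inner_commute)
  show "c * norm d \<le> norm (F m A x)"
  proof (cases "d = 0")
    case False
    have "(c * norm d) * norm d = c * (d \<bullet> d)"
      by (simp add: power2_norm_eq_inner[symmetric] power2_eq_square)
    also have "\<dots> \<le> norm (F m A x) * norm d"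
      using est norm_cauchy_schwarz[of "F m A x" "- d"] by simp
    finally show ?thesis
      using False by simp
  qed simp
  show "F m A x \<bullet> F m A x = - (F m A x \<bullet> (F' m A x *v d))"
    using d(2)[OF inner_F_self[OF assms(1), of m A]] by simp
qed

lemma newton_direction_curve_descent:
  fixes x :: "real^'n::finite"
  assumes "m \<ge> 1" "symmetric_tensor m A" "x \<bullet> x = 1" "perp_basis x (U x)"
    and "c > 0" "tangent_coercive m A c x" "newton_direction m A U x d" "F m A x \<noteq> 0"
  shows "curve_descent (phi m A) x d"
proof (rule neg_imp_curve_descent[OF assms(1-3)])
  note est = newton_direction_estimates[where U = U, OF assms(3,4,6,7)]
  have "d \<noteq> 0"
    using est(4) assms(8) by auto
  then have "0 < c * (d \<bullet> d)"
    using \<open>c > 0\<close> by simp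
  with est(2) show "F m A x \<bullet> d < 0"
    by simp
qed

text \<open>A Newton direction exists and every one is a curve descent direction, so both conditions
  that open the fallback fail.\<close>

lemma search_direction_newton:
  fixes x :: "real^'n::finite"
  assumes "m \<ge> 1" "symmetric_tensor m A" "x \<bullet> x = 1" "perp_basis x (U x)"
    and "c > 0" "tangent_coercive m A c x" "F m A x \<noteq> 0" "search_direction m A U \<mu> x d"
  shows "newton_direction m A U x d"
  using newton_direction_exists[where U = U, OF assms(3-6)] newton_direction_curve_descent[where U = U, OF assms(1-6) _ assms(7)]
    assms(8)
  unfolding search_direction_def by blast

lemma search_direction_nonpos:
  fixes x :: "real^'n::finite"
  assumes "m \<ge> 1" "symmetric_tensor m A" "x \<bullet> x = 1" "search_direction m A U \<mu> x d"
  shows "F m A x \<bullet> d \<le> 0"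
proof -
  consider "curve_descent (phi m A) x d" | "projected_gradient_direction m A x d"
    using assms(4) unfolding search_direction_def by blast
  then show ?thesis
  proof cases
    case 1
    then show ?thesis
      by (rule curve_descent_imp_nonpos[OF assms(1-3)])
  next
    case 2
    \<comment> \<open>The projected gradient is exactly \<open>F m A x\<close>, because
      \<open>tensor_pow m A x\<close> is the component of the gradient along
      \<open>x\<close>.\<close>
    then have "d = - F m A x"
      by (simp add: projected_gradient_direction_def F_def tensor_pow_def
          matrix_vector_mult_diff_rdistrib outer_mult_vec)
    then show ?thesis
      by simp
  qed
qed

section \<open>Lower bounds for accepted step lengths\<close>

lemma backtracking_step_ge:
  assumes "backtracking_step m A \<sigma> \<rho> x d \<alpha>" "0 < \<rho>" "\<rho> < 1"
    and "\<And>t. 0 < t \<Longrightarrow> t \<le> T \<Longrightarrow> acceptable_step m A \<sigma> x d t"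
  shows "min 1 (\<rho> * T) \<le> \<alpha>"
proof -
  obtain j where j: "\<alpha> = \<rho> ^ j" "\<And>i. i < j \<Longrightarrow> \<not> acceptable_step m A \<sigma> x d (\<rho> ^ i)"
    using assms(1) by (auto simp: backtracking_step_def)
  show ?thesis
  proof (cases j)
    case 0
    then show ?thesis
      using j by simp
  next
    \<comment> \<open>The trial just before the accepted one was rejected, so it exceeds
      \<open>T\<close>; one further factor \<open>\<rho>\<close> leaves more than
      \<open>\<rho> * T\<close>.\<close>
    case (Suc i)
    then have "\<not> \<rho> ^ i \<le> T"
      using j(2)[of i] assms(4)[of "\<rho> ^ i"] \<open>0 < \<rho>\<close> by auto
    then show ?thesis
      using \<open>0 < \<rho>\<close> by (simp add: j(1) Suc min_le_iff_disj)
  qed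
qed
lemma newton_step_length_bound:
  fixes A :: "'n::finite tensor"
  assumes "m \<ge> 2" "symmetric_tensor m A" "\<sigma> < 1" "0 < \<rho>" "\<rho> < 1" "c > 0"
  obtains a where "a > 0"
    "\<And>x d \<alpha>. x \<bullet> x = 1 \<Longrightarrow> x \<bullet> d = 0 \<Longrightarrow> c * (d \<bullet> d) \<le> - (F m A x \<bullet> d) \<Longrightarrow>
       backtracking_step m A \<sigma> \<rho> x d \<alpha> \<Longrightarrow> a \<le> \<alpha>"
proof -
  obtain C where "C > 0" and C: "\<And>x d \<alpha>. x \<bullet> x = 1 \<Longrightarrow> x \<bullet> d = 0 \<Longrightarrow>
       phi m A (curve x d \<alpha>) \<le> phi m A x + \<alpha> * (F m A x \<bullet> d) + C * \<alpha>\<^sup>2 * (d \<bullet> d)"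
    using phi_curve_le[OF assms(1,2)] by metis
  \<comment> \<open>Up to \<open>T\<close> the quadratic error
    \<open>C * t * (d \<bullet> d)\<close> is absorbed by the part \<open>1 - \<sigma>\<close> of
    the linear decrease that the line search does not demand.\<close>
  define T where "T = (1 - \<sigma>) * c / C"
  have "T > 0"
    using assms \<open>C > 0\<close> by (simp add: T_def)
  show ?thesis
  proof (rule that[of "min 1 (\<rho> * T)"])
    show "min 1 (\<rho> * T) > 0"
      using \<open>T > 0\<close> \<open>0 < \<rho>\<close> by simp
    fix x d :: "real^'n" and \<alpha>
    assume x: "x \<bullet> x = 1" and d: "x \<bullet> d = 0" and est: "c * (d \<bullet> d) \<le> - (F m A x \<bullet> d)"
      and step: "backtracking_step m A \<sigma> \<rho> x d \<alpha>"
    show "min 1 (\<rho> * T) \<le> \<alpha>"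
    proof (rule backtracking_step_ge[OF step \<open>0 < \<rho>\<close> \<open>\<rho> < 1\<close>])
      fix t :: real
      assume t: "0 < t" "t \<le> T"
      then have "C * t \<le> (1 - \<sigma>) * c"
        using \<open>C > 0\<close> by (simp add: T_def field_simps)
      then have "(C * t) * (d \<bullet> d) \<le> ((1 - \<sigma>) * c) * (d \<bullet> d)"
        by (intro mult_right_mono) auto
      also have "\<dots> \<le> (1 - \<sigma>) * - (F m A x \<bullet> d)"
        using mult_left_mono[OF est, of "1 - \<sigma>"] \<open>\<sigma> < 1\<close> by (simp add: mult_ac)
      finally have "t * (C * t * (d \<bullet> d)) \<le> t * ((1 - \<sigma>) * - (F m A x \<bullet> d))"
        using t by (intro mult_left_mono) auto
      then show "acceptable_step m A \<sigma> x d t"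
        using C[OF x d, of t] tangent_step_nonzero[OF x d, of t]
        by (simp add: acceptable_step_def power2_eq_square algebra_simps)
    qed
  qed
qed

text \<open>
  On the sphere \<open>phi\<close> differs by a constant from \<open>\<lambda>y. phi m A y - l / 2 * (y \<bullet> y)\<close> with
  \<open>l = tensor_pow m A x\<close>, which is stationary at \<open>x\<close> and whose Hessian agrees with \<open>F' m A x\<close>
  as a quadratic form on the tangent space.
\<close>

lemma tangent_coercive_imp_strict_local_min:
  fixes x :: "real^'n::finite"
  assumes "m \<ge> 2" "symmetric_tensor m A" "x \<bullet> x = 1" "F m A x = 0" "c > 0" "tangent_coercive m A c x"
  obtains r where "r > 0"
    "\<And>y. y \<bullet> y = 1 \<Longrightarrow> y \<noteq> x \<Longrightarrow> dist y x < r \<Longrightarrow> phi m A x < phi m A y"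
proof -
  define l where "l = tensor_pow m A x"
  define H where "H v = (real m - 1) *\<^sub>R (tensor_pow2 m A x *v v) - l *\<^sub>R v" for v
  have gx: "tensor_pow1 m A x = l *\<^sub>R x"
    using assms(4) by (simp add: F_def l_def)
  have linH: "linear H"
    by (rule linearI)
       (simp_all add: H_def matrix_vector_right_distrib matrix_vector_mult_scaleR algebra_simps)
  obtain K where "K > 0" and K: "\<And>v. norm (H v) \<le> K * norm v"
    using linear_bounded_pos[OF linH] by metis
  have tangent: "c * (u \<bullet> u) \<le> u \<bullet> H u" if "x \<bullet> u = 0" for u
    using tangent_coerciveD[OF assms(6) that] inner_F'_tangent[OF that, of m A u]
    by (simp add: H_def l_def inner_diff_right)
  have "((\<lambda>y. tensor_pow1 m A y - l *\<^sub>R y) has_derivative H) (at x)"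
    unfolding H_def[abs_def]
    by (intro has_derivative_diff has_derivative_tensor_pow1 assms has_derivative_scaleR_right
        has_derivative_ident)
  \<comment> \<open>The quadratic term will retain \<open>c / 2\<close>; a linearization error with
    factor \<open>c / 4\<close> still leaves a positive gain.\<close>
  moreover have "c / 4 > 0"
    using \<open>c > 0\<close> by simp
  ultimately obtain \<delta> where "\<delta> > 0" and \<delta>: "\<And>y. norm (y - x) < \<delta> \<Longrightarrow>
      norm (tensor_pow1 m A y - l *\<^sub>R y - (tensor_pow1 m A x - l *\<^sub>R x) - H (y - x)) \<le> c / 4 * norm (y - x)"
    unfolding has_derivative_at_alt by blast
  \<comment> \<open>The bound \<open>\<delta>\<close> permits the linearization, 1 gives
    \<open>s \<le> norm w\<close>, and the quotient makes the loss from \<open>w\<close> not being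
    tangent at most \<open>c / 2 * (w \<bullet> w)\<close>.\<close>
  define r where "r = min \<delta> (min 1 (c / (c + 4 * K)))"
  have r: "r > 0" "r \<le> \<delta>" "r \<le> 1" "r \<le> c / (c + 4 * K)"
    using \<open>\<delta> > 0\<close> \<open>c > 0\<close> \<open>K > 0\<close> by (simp_all add: r_def min_le_iff_disj)
  show ?thesis
  proof (rule that[OF r(1)])
    fix y
    assume y: "y \<bullet> y = 1" "y \<noteq> x" "dist y x < r"
    \<comment> \<open>The chord \<open>w\<close> is not tangent at \<open>x\<close>: its normal
      component is \<open>- s\<close>, of second order, and \<open>u\<close> is its tangential
      part.\<close>
    define w where "w = y - x"
    define s where "s = (w \<bullet> w) / 2"
    define u where "u = w + s *\<^sub>R x"
    have w: "0 < norm w" "norm w < r"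
      using y by (auto simp: w_def dist_norm)
    have xw: "x \<bullet> w = - s"
      using y(1) assms(3) by (simp add: s_def w_def inner_simps inner_commute diff_divide_distrib)
    have s: "s = (norm w)\<^sup>2 / 2" "s \<ge> 0"
      by (simp_all add: s_def power2_norm_eq_inner)
    have xu: "x \<bullet> u = 0"
      by (simp add: u_def inner_add_right xw assms(3))
    have uu: "u \<bullet> u = w \<bullet> w - s\<^sup>2"
      by (simp add: u_def inner_add_left inner_add_right inner_commute[of w x] xw assms(3)
          power2_eq_square)
    have "u \<bullet> u \<le> w \<bullet> w"
      by (simp add: uu)
    then have uw: "norm u \<le> norm w"
      by (simp add: norm_le)
    have nx: "norm x = 1"
      using assms(3) by (simp add: norm_eq_sqrt_inner)
    have "u \<bullet> H u = w \<bullet> H u + s * (x \<bullet> H u)"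
      by (subst u_def) (simp add: inner_add_left)
    moreover have "H u = H w + s *\<^sub>R H x"
      by (simp add: u_def linear_add[OF linH] linear_scale[OF linH])
    then have "w \<bullet> H u = w \<bullet> H w + s * (w \<bullet> H x)"
      by (simp add: inner_add_right)
    \<comment> \<open>Coercivity is known for \<open>u\<close> only; passing to \<open>w\<close>
      costs terms of size at most \<open>s * K * norm w\<close>, cubic in
      \<open>norm w\<close>.\<close>
    ultimately have "w \<bullet> H w = u \<bullet> H u - s * (x \<bullet> H u) - s * (w \<bullet> H x)"
      by simp
    moreover have "x \<bullet> H u \<le> K * norm w"
    proof -
      have "x \<bullet> H u \<le> norm (H u)"
        using norm_cauchy_schwarz[of x "H u"] nx by simp
      also have "\<dots> \<le> K * norm w"
        using K[of u] uw \<open>K > 0\<close> by (meson mult_left_mono less_imp_le order_trans)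
      finally show ?thesis .
    qed
    moreover have "w \<bullet> H x \<le> K * norm w"
    proof -
      have "w \<bullet> H x \<le> norm w * norm (H x)"
        by (rule norm_cauchy_schwarz)
      also have "\<dots> \<le> norm w * K"
        using K[of x] nx by (intro mult_left_mono) auto
      finally show ?thesis
        by (simp add: mult.commute)
    qed
    ultimately have "w \<bullet> H w \<ge> c * (u \<bullet> u) - s * (K * norm w) - s * (K * norm w)"
      using tangent[OF xu] s(2) by (smt (verit) mult_left_mono)
    moreover have "c * s\<^sup>2 + 2 * s * (K * norm w) \<le> c / 2 * (w \<bullet> w)"
    proof -
      have "norm w * norm w \<le> norm w"
        by (rule mult_left_le) (use w r(3) in auto)
      moreover have "0 \<le> norm w * norm w"
        by simp
      ultimately have "s \<le> norm w"
        unfolding s(1) power2_eq_square by linarith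
      then have "c * s\<^sup>2 + 2 * s * (K * norm w) \<le> c * s * norm w + 2 * s * (K * norm w)"
        using \<open>c > 0\<close> s(2) by (simp add: power2_eq_square mult_left_mono)
      also have "\<dots> = s * ((c + 2 * K) * norm w)"
        by (simp add: algebra_simps)
      also have "\<dots> \<le> s * c"
      proof (intro mult_left_mono s(2))
        have "norm w \<le> c / (c + 4 * K)"
          using w r by simp
        then have "(c + 4 * K) * norm w \<le> c"
          using \<open>c > 0\<close> \<open>K > 0\<close> by (simp add: field_simps)
        moreover have "0 \<le> K * norm w"
          using \<open>K > 0\<close> by simp
        ultimately show "(c + 2 * K) * norm w \<le> c"
          by (simp add: algebra_simps)
      qed
      finally show ?thesis
        by (simp add: s_def mult.commute)
    qed
    ultimately have wHw: "w \<bullet> H w \<ge> c / 2 * (w \<bullet> w)"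
      by (simp add: uu algebra_simps)
    define h where "h z = phi m A z - l / 2 * (z \<bullet> z)" for z
    have h': "(h has_derivative (\<lambda>v. (tensor_pow1 m A z - l *\<^sub>R z) \<bullet> v)) (at z)" for z
      unfolding h_def[abs_def]
      using assms(1,2) by (auto intro!: derivative_eq_intros has_derivative_phi
          simp: fun_eq_iff inner_diff_left inner_diff_right inner_commute)
    obtain t where t: "0 < t" "t < 1"
      "h y - h x = (tensor_pow1 m A (x + t *\<^sub>R (y - x)) - l *\<^sub>R (x + t *\<^sub>R (y - x))) \<bullet> (y - x)"
      using gradient_mean_value[OF h'] by blast
    \<comment> \<open>\<open>R\<close> is the linearization error of the gradient of
      \<open>h\<close>, which vanishes at \<open>x\<close>.\<close>
    define R where "R = tensor_pow1 m A (x + t *\<^sub>R w) - l *\<^sub>R (x + t *\<^sub>R w) - H (t *\<^sub>R w)"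
    have "t * norm w \<le> 1 * norm w"
      using t by (intro mult_right_mono) auto
    then have "norm R \<le> c / 4 * norm (t *\<^sub>R w)"
      using \<delta>[of "x + t *\<^sub>R w"] t w r by (simp add: R_def gx)
    then have "norm R * norm w \<le> (c / 4 * (t * norm w)) * norm w"
      using t by (intro mult_right_mono) auto
    moreover have "- (R \<bullet> w) \<le> norm R * norm w"
      using norm_cauchy_schwarz[of "- R" w] by simp
    ultimately have "- (R \<bullet> w) \<le> t * (c / 4 * (w \<bullet> w))"
      by (simp add: power2_norm_eq_inner[symmetric] power2_eq_square mult_ac)
    moreover have "h y - h x = t * (w \<bullet> H w) + R \<bullet> w"
      unfolding t(3) by (simp add: R_def w_def[symmetric] linear_scale[OF linH] inner_diff_left
          inner_commute[of w "H w"])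
    moreover have "t * (w \<bullet> H w) \<ge> t * (c / 2 * (w \<bullet> w))"
      using t wHw by (intro mult_left_mono) auto
    moreover have "t * (c * (w \<bullet> w)) > 0"
      using t \<open>c > 0\<close> w by simp
    ultimately have "h y - h x > 0"
      by (simp add: algebra_simps)
    then show "phi m A x < phi m A y"
      using y(1) assms(3) by (simp add: h_def)
  qed
qed
section \<open>Convergence of the iterates\<close>

text \<open>A trapping argument. On a shell around \<open>l\<close> the values of \<open>f\<close>
  stay above some \<open>b > f l\<close>. Once an iterate is inside the shell with value below
  \<open>b\<close>, short steps cannot jump across it and the descent forbids landing in it.\<close>

lemma accumulating_descent_converges:
  fixes x :: "nat \<Rightarrow> 'a::metric_space" and f :: "'a \<Rightarrow> real"
  assumes "compact S" "continuous_on S f" "\<And>k. x k \<in> S" "\<And>k. f (x (Suc k)) \<le> f (x k)"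
    and "accumulation_point x l" "r > 0"
    and min: "\<And>y. y \<in> S \<Longrightarrow> y \<noteq> l \<Longrightarrow> dist y l < r \<Longrightarrow> f l < f y"
    and step: "\<And>e. e > 0 \<Longrightarrow> \<exists>\<delta>>0. \<forall>k. dist (x k) l < \<delta> \<longrightarrow> dist (x (Suc k)) (x k) < e"
  shows "x \<longlonglongrightarrow> l"
proof (rule metric_LIMSEQ_I)
  fix e :: real
  assume "e > 0"
  define e' where "e' = min e (r / 2)"
  have e': "e' > 0" "e' \<le> e" "e' < r"
    using \<open>e > 0\<close> \<open>r > 0\<close> by (auto simp: e'_def)
  obtain \<delta>0 where "\<delta>0 > 0" and \<delta>0: "\<And>k. dist (x k) l < \<delta>0 \<Longrightarrow> dist (x (Suc k)) (x k) < e' / 2"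
    using step[of "e' / 2"] e' by auto
  \<comment> \<open>From the \<open>\<delta>\<close>-ball a step shorter than \<open>e' / 2\<close>
    ends within \<open>e'\<close> of \<open>l\<close>, so leaving the ball would mean entering
    \<open>K\<close>.\<close>
  define \<delta> where "\<delta> = min \<delta>0 (e' / 2)"
  have \<delta>: "\<delta> > 0" "\<delta> \<le> \<delta>0" "\<delta> \<le> e' / 2"
    using \<open>\<delta>0 > 0\<close> e' by (auto simp: \<delta>_def)
  define K where "K = S \<inter> (cball l e' - ball l \<delta>)"
  have K: "y \<in> K \<longleftrightarrow> y \<in> S \<and> \<delta> \<le> dist y l \<and> dist y l \<le> e'" for y
    by (auto simp: K_def dist_commute)
  have "compact K"
    unfolding K_def by (intro compact_Int_closed closed_Diff assms(1)) auto
  have less: "f l < f y" if "y \<in> K" for y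
    using that \<delta>(1) e' by (intro min) (auto simp: K)
  obtain b where "f l < b" and b: "\<And>y. y \<in> K \<Longrightarrow> b \<le> f y"
  proof (cases "K = {}")
    case True
    then show ?thesis
      by (intro that[of "f l + 1"]) auto
  next
    case False
    have "K \<subseteq> S"
      by (auto simp: K_def)
    then obtain z where "z \<in> K" "\<And>y. y \<in> K \<Longrightarrow> f z \<le> f y"
      using continuous_attains_inf[OF \<open>compact K\<close> False continuous_on_subset[OF assms(2)]] by blast
    with less show ?thesis
      by (intro that[of "f z"]) auto
  qed
  obtain q where q: "(x \<circ> q) \<longlonglongrightarrow> l"
    using assms(5) by (auto simp: accumulation_point_def)
  have "l \<in> S"
    by (rule closed_sequentially[OF compact_imp_closed[OF assms(1)] _ q]) (simp add: assms(3))
  then have "(\<lambda>n. f ((x \<circ> q) n)) \<longlonglongrightarrow> f l"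
    by (intro continuous_on_tendsto_compose[OF assms(2) q]) (auto simp: assms(3))
  then have "\<forall>\<^sub>F n in sequentially. f ((x \<circ> q) n) < b \<and> dist ((x \<circ> q) n) l < \<delta>"
    using \<open>f l < b\<close> by (intro eventually_conj order_tendstoD(2) tendstoD[OF q \<delta>(1)])
  then obtain k0 where k0: "dist (x k0) l < \<delta>" "f (x k0) < b"
    by (auto simp: eventually_sequentially)
  have "dist (x k) l < \<delta> \<and> f (x k) < b" if "k \<ge> k0" for k
    using that
  proof (induction k rule: dec_induct)
    case (step k)
    have fb: "f (x (Suc k)) < b"
      using step.IH assms(4)[of k] by simp
    have "dist (x (Suc k)) l \<le> dist (x (Suc k)) (x k) + dist (x k) l"
      by (rule dist_triangle)
    also have "\<dots> \<le> e'"
      using \<delta>0[of k] step.IH \<delta> by simp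
    finally have "x (Suc k) \<in> K" if "\<not> dist (x (Suc k)) l < \<delta>"
      using that assms(3) by (simp add: K)
    with fb b[of "x (Suc k)"] show ?case
      by fastforce
  qed (use k0 in auto)
  then show "\<exists>k0. \<forall>k\<ge>k0. dist (x k) l < e"
    using \<delta> e' by (intro exI[of _ k0]) force
qed

text \<open>As \<open>n \<le> r n\<close>, the limit along the subsequence bounds the whole sequence
  from below, so monotone convergence applies.\<close>

lemma decseq_subseq_LIMSEQ:
  fixes f :: "nat \<Rightarrow> real"
  assumes "decseq f" "strict_mono r" "(f \<circ> r) \<longlonglongrightarrow> l"
  shows "f \<longlonglongrightarrow> l"
proof -
  have "decseq (f \<circ> r)"
    using assms(1,2) by (auto simp: decseq_def strict_mono_less_eq)
  then have "l \<le> (f \<circ> r) n" for n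
    by (rule decseq_ge[OF _ assms(3)])
  then have "l \<le> f n" for n
    using decseqD[OF assms(1) seq_suble[OF assms(2), of n]] by (metis comp_apply order_trans)
  then obtain L where L: "f \<longlonglongrightarrow> L"
    using decseq_convergent[OF assms(1)] by metis
  then have "L = l"
    using LIMSEQ_unique[OF LIMSEQ_subseq_LIMSEQ[OF L assms(2)] assms(3)] by simp
  with L show ?thesis
    by simp
qed

section \<open>Invariants of a run\<close>

lemma global_newton_run_unit:
  assumes "global_newton_run m A U \<sigma> \<mu> \<rho> N x d \<alpha>" "enat k \<le> N"
  shows "x k \<bullet> x k = 1"
proof (cases k)
  case 0
  then show ?thesis
    using assms(1) by (simp add: global_newton_run_def unit_vectors_def)
next
  case (Suc j)
  then have "enat j < N"
    using assms(2) by (simp add: Suc_ile_eq)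
  then have "x k = curve (x j) (d j) (\<alpha> j)" "x j + \<alpha> j *\<^sub>R d j \<noteq> 0"
    using assms(1)
    by (auto simp: global_newton_run_def backtracking_step_def acceptable_step_def Suc)
  then show ?thesis
    by (simp add: curve_unit)
qed

lemma backtracking_stepD:
  assumes "backtracking_step m A \<sigma> \<rho> x d \<alpha>" "0 < \<rho>" "\<rho> < 1"
  shows "0 < \<alpha>" "\<alpha> \<le> 1" "phi m A (curve x d \<alpha>) \<le> phi m A x + \<sigma> * \<alpha> * (F m A x \<bullet> d)"
  using assms by (auto simp: backtracking_step_def acceptable_step_def power_le_one)

text \<open>The line search guarantees a decrease of
  \<open>- \<sigma> * \<alpha> k * (F m A (x k) \<bullet> d k)\<close>. This is 0 when the slope
  vanishes, which curve descent alone does not exclude, hence the condition for strictness.\<close>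

lemma global_newton_run_decrease:
  fixes A :: "'n::finite tensor"
  assumes "m \<ge> 1" "symmetric_tensor m A" "0 < \<sigma>" "0 < \<rho>" "\<rho> < 1"
    and run: "global_newton_run m A U \<sigma> \<mu> \<rho> N x d \<alpha>" and "enat k < N"
  shows "phi m A (x (Suc k)) \<le> phi m A (x k)"
    and "F m A (x k) \<bullet> d k \<noteq> 0 \<Longrightarrow> phi m A (x (Suc k)) < phi m A (x k)"
proof -
  have k: "search_direction m A U \<mu> (x k) (d k)" "backtracking_step m A \<sigma> \<rho> (x k) (d k) (\<alpha> k)"
    "x (Suc k) = curve (x k) (d k) (\<alpha> k)"
    using run \<open>enat k < N\<close> by (auto simp: global_newton_run_def)
  have "x k \<bullet> x k = 1"
    using global_newton_run_unit[OF run] \<open>enat k < N\<close> by simp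
  from search_direction_nonpos[OF assms(1,2) this k(1)] have nonpos: "F m A (x k) \<bullet> d k \<le> 0" .
  note step = backtracking_stepD[OF k(2) \<open>0 < \<rho>\<close> \<open>\<rho> < 1\<close>, folded k(3)]
  have pos: "0 < \<sigma> * \<alpha> k"
    using \<open>0 < \<sigma>\<close> step(1) by simp
  then show "phi m A (x (Suc k)) \<le> phi m A (x k)"
    using step(3) mult_nonneg_nonpos[OF less_imp_le[OF pos] nonpos] by simp
  assume "F m A (x k) \<bullet> d k \<noteq> 0"
  then show "phi m A (x (Suc k)) < phi m A (x k)"
    using step(3) nonpos mult_pos_neg[OF pos, of "F m A (x k) \<bullet> d k"] by simp
qed

section \<open>Convergence under the second order condition\<close>

lemma global_newton_run_convergence:
  fixes A :: "'n::finite tensor" and U :: "real^'n \<Rightarrow> nat \<Rightarrow> real^'n"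
  assumes "m \<ge> 2" "symmetric_tensor m A"
    and basis: "\<And>y. y \<in> unit_vectors \<Longrightarrow> perp_basis y (U y)"
    and "0 < \<sigma>" "\<sigma> < 1" "0 < \<rho>" "\<rho> < 1"
    and run: "global_newton_run m A U \<sigma> \<mu> \<rho> \<infinity> x d \<alpha>"
    and acc: "accumulation_point x xbar" and sos: "second_order_sufficient m A U xbar"
  shows "F m A xbar = 0" "xbar \<bullet> xbar = 1" "x \<longlonglongrightarrow> xbar"
proof -
  have "m \<ge> 1"
    using \<open>m \<ge> 2\<close> by simp
  have unit: "x k \<bullet> x k = 1" for k
    using global_newton_run_unit[OF run] by simp
  have k: "F m A (x k) \<noteq> 0" "search_direction m A U \<mu> (x k) (d k)"
    "backtracking_step m A \<sigma> \<rho> (x k) (d k) (\<alpha> k)" "x (Suc k) = curve (x k) (d k) (\<alpha> k)" for k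
    using run by (auto simp: global_newton_run_def)
  have dec: "phi m A (x (Suc k)) \<le> phi m A (x k)" for k
    using global_newton_run_decrease(1)[OF \<open>m \<ge> 1\<close> assms(2,4,6,7) run] by simp
  note step = backtracking_stepD[OF k(3) \<open>0 < \<rho>\<close> \<open>\<rho> < 1\<close>, folded k(4)]
  obtain r where r: "strict_mono r" and xr: "(x \<circ> r) \<longlonglongrightarrow> xbar"
    using acc by (auto simp: accumulation_point_def)
  have "(\<lambda>n. (x \<circ> r) n \<bullet> (x \<circ> r) n) \<longlonglongrightarrow> xbar \<bullet> xbar"
    by (intro tendsto_inner xr)
  then show xbar: "xbar \<bullet> xbar = 1"
    by (simp add: unit LIMSEQ_const_iff)
  obtain c e where "c > 0" "e > 0"
    and coercive: "\<And>y. y \<bullet> y = 1 \<Longrightarrow> dist y xbar < e \<Longrightarrow> tangent_coercive m A c y"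
    using second_order_sufficient_imp_coercive_nearby[where U = U, OF xbar basis sos] xbar
    by (auto simp: unit_vectors_def)
  have near: "x k \<bullet> d k = 0" "c * (d k \<bullet> d k) \<le> - (F m A (x k) \<bullet> d k)"
    "c * norm (d k) \<le> norm (F m A (x k))"
    "F m A (x k) \<bullet> F m A (x k) = - (F m A (x k) \<bullet> (F' m A (x k) *v d k))"
    if "dist (x k) xbar < e" for k
  proof -
    have b: "perp_basis (x k) (U (x k))"
      by (rule basis) (simp add: unit_vectors_def unit)
    have t: "tangent_coercive m A c (x k)"
      by (rule coercive[OF unit that])
    have n: "newton_direction m A U (x k) (d k)"
      by (rule search_direction_newton[where U = U, OF \<open>m \<ge> 1\<close> assms(2) unit b \<open>c > 0\<close> t k(1,2)])
    note newton_direction_estimates[where U = U, OF unit b t n]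
    then show "x k \<bullet> d k = 0" "c * (d k \<bullet> d k) \<le> - (F m A (x k) \<bullet> d k)"
      "c * norm (d k) \<le> norm (F m A (x k))"
      "F m A (x k) \<bullet> F m A (x k) = - (F m A (x k) \<bullet> (F' m A (x k) *v d k))"
      by blast+
  qed
  obtain a where "a > 0" and a: "\<And>x d \<alpha>. x \<bullet> x = 1 \<Longrightarrow> x \<bullet> d = 0 \<Longrightarrow>
      c * (d \<bullet> d) \<le> - (F m A x \<bullet> d) \<Longrightarrow> backtracking_step m A \<sigma> \<rho> x d \<alpha> \<Longrightarrow> a \<le> \<alpha>"
    using newton_step_length_bound[OF assms(1,2,5,6,7) \<open>c > 0\<close>] by metis
  \<comment> \<open>Close to \<open>xbar\<close> the step length is at least \<open>a\<close> and
    the slope at most \<open>- c * (d k \<bullet> d k)\<close>, so the decrease of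
    \<open>phi\<close> dominates the squared direction.\<close>
  have d_bound: "(norm (d k))\<^sup>2 \<le> (phi m A (x k) - phi m A (x (Suc k))) / (\<sigma> * a * c)"
    if "dist (x k) xbar < e" for k
  proof -
    note n = near[OF that]
    have "(\<sigma> * a) * (c * (d k \<bullet> d k)) \<le> (\<sigma> * \<alpha> k) * (c * (d k \<bullet> d k))"
      using a[OF unit n(1,2) k(3)] \<open>0 < \<sigma>\<close> \<open>c > 0\<close> by (intro mult_right_mono mult_left_mono) auto
    also have "\<dots> \<le> (\<sigma> * \<alpha> k) * - (F m A (x k) \<bullet> d k)"
      using n(2) \<open>0 < \<sigma>\<close> step(1)[of k] by (intro mult_left_mono) auto
    also have "\<dots> \<le> phi m A (x k) - phi m A (x (Suc k))"
      using step(3)[of k] by simp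
    finally show ?thesis
      using \<open>0 < \<sigma>\<close> \<open>a > 0\<close> \<open>c > 0\<close> by (simp add: power2_norm_eq_inner field_simps)
  qed
  have cont_phi: "continuous_on UNIV (phi m A)" and cont_F: "continuous_on UNIV (F m A)"
    by (intro continuous_intros)+
  \<comment> \<open>Convergence along the subsequence would not suffice: the decreases involve
    \<open>x (Suc (r n))\<close>, which need not belong to it.\<close>
  have lim: "(\<lambda>k. phi m A (x k)) \<longlonglongrightarrow> phi m A xbar"
  proof (rule decseq_subseq_LIMSEQ[OF _ r])
    show "decseq (\<lambda>k. phi m A (x k))"
      using dec by (simp add: decseq_Suc_iff)
    show "((\<lambda>k. phi m A (x k)) \<circ> r) \<longlonglongrightarrow> phi m A xbar"
      using continuous_on_tendsto_compose[OF cont_phi xr] by (simp add: o_def)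
  qed
  have "(\<lambda>k. (phi m A (x k) - phi m A (x (Suc k))) / (\<sigma> * a * c)) \<longlonglongrightarrow>
      (phi m A xbar - phi m A xbar) / (\<sigma> * a * c)"
    using \<open>0 < \<sigma>\<close> \<open>a > 0\<close> \<open>c > 0\<close> by (intro tendsto_intros lim LIMSEQ_Suc[OF lim]) auto
  from LIMSEQ_subseq_LIMSEQ[OF this r]
  have diff: "(\<lambda>n. (phi m A (x (r n)) - phi m A (x (Suc (r n)))) / (\<sigma> * a * c)) \<longlonglongrightarrow> 0"
    by (simp add: o_def)
  have ev: "\<forall>\<^sub>F n in sequentially. dist (x (r n)) xbar < e"
    using tendstoD[OF xr \<open>e > 0\<close>] by simp
  have "(\<lambda>n. (norm (d (r n)))\<^sup>2) \<longlonglongrightarrow> 0"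
    by (rule tendsto_sandwich[OF _ _ tendsto_const diff])
       (use ev in \<open>auto elim!: eventually_mono intro: d_bound\<close>)
  then have dr: "(d \<circ> r) \<longlonglongrightarrow> 0"
    using tendsto_real_sqrt[of "\<lambda>n. (norm (d (r n)))\<^sup>2" 0] by (simp add: tendsto_norm_zero_iff o_def)
  \<comment> \<open>The last Newton estimate writes the squared norm of \<open>F\<close> as an
    expression that vanishes with \<open>d\<close>, jointly continuous in point and
    direction.\<close>
  have "continuous_on UNIV (\<lambda>p. - (F m A (fst p) \<bullet> (F' m A (fst p) *v snd p)))"
    by (intro continuous_intros)
  from continuous_on_tendsto_compose[OF this tendsto_Pair[OF xr dr]]
  have "(\<lambda>n. - (F m A (x (r n)) \<bullet> (F' m A (x (r n)) *v d (r n)))) \<longlonglongrightarrow> 0"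
    by simp
  then have "(\<lambda>n. F m A (x (r n)) \<bullet> F m A (x (r n))) \<longlonglongrightarrow> 0"
    by (rule Lim_transform_eventually) (use ev near(4) in \<open>auto elim!: eventually_mono\<close>)
  moreover have "(\<lambda>n. F m A (x (r n)) \<bullet> F m A (x (r n))) \<longlonglongrightarrow> F m A xbar \<bullet> F m A xbar"
    using continuous_on_tendsto_compose[OF cont_F xr] by (intro tendsto_inner) (simp_all add: o_def)
  ultimately show F0: "F m A xbar = 0"
    using LIMSEQ_unique by fastforce
  obtain q where "q > 0"
    and q: "\<And>y. y \<bullet> y = 1 \<Longrightarrow> y \<noteq> xbar \<Longrightarrow> dist y xbar < q \<Longrightarrow> phi m A xbar < phi m A y"
    using tangent_coercive_imp_strict_local_min[OF assms(1,2) xbar F0 \<open>c > 0\<close> coercive[OF xbar]]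
      \<open>e > 0\<close> by auto
  show "x \<longlonglongrightarrow> xbar"
  proof (rule accumulating_descent_converges[OF compact_sphere[of 0 1] continuous_on_subset[OF cont_phi]
        _ dec acc \<open>q > 0\<close>])
    fix \<epsilon> :: real
    assume "\<epsilon> > 0"
    \<comment> \<open>If \<open>norm (F m A (x k)) < c * \<epsilon> / 2\<close>, then
      \<open>norm (d k) < \<epsilon> / 2\<close>, and the move on the sphere is at most twice
      that.\<close>
    then have "c * \<epsilon> / 2 > 0"
      using \<open>c > 0\<close> by simp
    then obtain \<delta> where "\<delta> > 0" and \<delta>: "\<And>y. dist y xbar < \<delta> \<Longrightarrow> norm (F m A y) < c * \<epsilon> / 2"
      using cont_F F0 unfolding continuous_on_iff by (metis UNIV_I dist_0_norm dist_commute)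
    have "dist (x (Suc k)) (x k) < \<epsilon>" if "dist (x k) xbar < min \<delta> e" for k
    proof -
      have "dist (x k) xbar < e"
        using that by simp
      note n = near[OF this]
      have "dist (x (Suc k)) (x k) \<le> 2 * norm (\<alpha> k *\<^sub>R d k)"
        using norm_curve_minus[OF unit n(1)] by (simp add: dist_norm k(4))
      also have "\<dots> \<le> 2 * norm (d k)"
        using step(1,2)[of k] by (simp add: mult_left_le_one_le)
      also have "\<dots> < \<epsilon>"
      proof -
        have "c * norm (d k) < c * (\<epsilon> / 2)"
          using n(3) \<delta>[of "x k"] that by simp
        then show ?thesis
          using \<open>c > 0\<close> by simp
      qed
      finally show ?thesis .
    qed
    then show "\<exists>\<delta>>0. \<forall>k. dist (x k) xbar < \<delta> \<longrightarrow> dist (x (Suc k)) (x k) < \<epsilon>"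
      using \<open>\<delta> > 0\<close> \<open>e > 0\<close> by (intro exI[of _ "min \<delta> e"]) auto
  qed (use q unit in \<open>auto simp: norm_eq_sqrt_inner\<close>)
qed

theorem theorem2p7:
  fixes m :: nat and A :: "'n::finite tensor"
    and U :: "real^'n \<Rightarrow> nat \<Rightarrow> real^'n"
    and \<sigma> \<mu> \<rho> :: real and N :: enat
    and x d :: "nat \<Rightarrow> real^'n" and \<alpha> :: "nat \<Rightarrow> real"
  assumes "m \<ge> 2" and "symmetric_tensor m A"
    and "\<And>y. y \<in> unit_vectors \<Longrightarrow> perp_basis y (U y)"
    and "0 < \<sigma>" and "\<sigma> < 1 / 2" and "\<mu> > 0" and "0 < \<rho>" and "\<rho> < 1"
    and "global_newton_run m A U \<sigma> \<mu> \<rho> N x d \<alpha>"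
  shows "bounded (x ` {k. enat k \<le> N}) \<and>
    (\<forall>k. enat k < N \<longrightarrow>
       phi m A (x (Suc k)) \<le> phi m A (x k) \<and>
       (F m A (x k) \<bullet> d k \<noteq> 0 \<longrightarrow> phi m A (x (Suc k)) < phi m A (x k))) \<and>
    (N = \<infinity> \<longrightarrow>
       (\<forall>xbar. accumulation_point x xbar \<and> second_order_sufficient m A U xbar \<longrightarrow>
          Z_eigenpair m A xbar (tensor_pow m A xbar) \<and>
          (\<forall>xt. accumulation_point x xt \<longrightarrow> Z_eigenpair m A xt (tensor_pow m A xt))))"
proof (intro conjI allI impI)
  have "m \<ge> 1" "\<sigma> < 1"
    using assms(1,5) by simp_all
  show "bounded (x ` {k. enat k \<le> N})"
    by (rule boundedI[of _ 1])
       (auto simp: norm_eq_sqrt_inner global_newton_run_unit[OF assms(9)])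
  note dec = global_newton_run_decrease[OF \<open>m \<ge> 1\<close> assms(2,4,7,8,9)]
  fix k
  assume "enat k < N"
  then show "phi m A (x (Suc k)) \<le> phi m A (x k)"
    by (rule dec(1))
  assume "F m A (x k) \<bullet> d k \<noteq> 0"
  with \<open>enat k < N\<close> show "phi m A (x (Suc k)) < phi m A (x k)"
    by (rule dec(2))
next
  fix xbar
  assume "N = \<infinity>" and xbar: "accumulation_point x xbar \<and> second_order_sufficient m A U xbar"
  have "\<sigma> < 1"
    using assms(5) by simp
  note conv = global_newton_run_convergence[where U = U, OF assms(1-4) \<open>\<sigma> < 1\<close> assms(7,8)
      assms(9)[unfolded \<open>N = \<infinity>\<close>] conjunct1[OF xbar] conjunct2[OF xbar]]
  show eig: "Z_eigenpair m A xbar (tensor_pow m A xbar)"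
    using conv(1,2) by (simp add: Z_eigenpair_iff_F)
  fix xt
  assume "accumulation_point x xt"
  then have "xt = xbar"
    unfolding accumulation_point_def
    using LIMSEQ_unique LIMSEQ_subseq_LIMSEQ[OF conv(3)] by blast
  with eig show "Z_eigenpair m A xt (tensor_pow m A xt)"
    by simp
qed

end
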